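(* Let $m,n,b$ be positive integers with $m\ge n$, let $\lambda=(m,n^b)$, let $\mu=(\mu_1,\ldots,\mu_{b+2})$ be a tuple of nonnegative integers with $\sum_{i=1}^{b+2}\mu_i=m+nb$, and let $$f(q)=\left[\begin{array}{c} b+\beta(\lambda,\mu)\\ \beta(\lambda,\mu)\end{array}\right]_q .$$ Then $$f(q)=q^{-n\binom{b+1}{2}}\,\widetilde{K}_{\lambda,\mu}(q),$$ where $\widetilde{K}_{\lambda,\mu}(q)$ is the modified Kostka-Foulkes polynomial.
   Context: Partition $(m,n^b)$: one part equal to $m$ followed by $b$ parts equal to $n$. $SSYT(\lambda,\mu)$ is the set of semistandard Young tableaux (English notation) of shape $\lambda$ with content $\mu$, i.e. with exactly $\mu_i$ entries equal to $i$. Definition of $\beta$: $\beta(\lambda,\mu)=m-n-\sum_{i=1}^{b+2}\gamma_i$, where $\gamma_i=\mu_i-n$ if $\mu_i>n$ and $\gamma_i=0$ otherwise. $q$-binomial coefficients: $[N]_q=\frac{q^N-1}{q-1}$, $[N]_q!=[N]_q[N-1]_q\cdots[1]_q$, and $\left[\begin{array}{c}N\\k\end{array}\right]_q=\frac{[N]_q!}{[k]_q![N-k]_q!}$. Convention: this is $0$ if $k<0$. Modified Kostka-Foulkes polynomials: for a partition $\mu$, $\widetilde{K}_{\lambda,\mu}(q)=q^{\kappa(\mu)}K_{\lambda,\mu}(q^{-1})$ with $\kappa(\mu)=\sum_i(i-1)\mu_i$ and $K_{\lambda,\mu}(q)$ the Kostka-Foulkes polynomial (the coefficients expressing Schur polynomials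 in Hall-Littlewood polynomials, $s_\lambda=\sum_\mu K_{\lambda,\mu}(q)P_\mu(x;q)$). Equivalently (Lascoux and Sch\"utzenberger), $\widetilde{K}_{\lambda,\mu}(q)=\sum_{T\in SSYT(\lambda,\mu)}q^{cc(T)}$, where $cc$ is the cocharge statistic defined below. If $\mu$ is not a partition, $\widetilde{K}_{\lambda,\mu}$ means $\widetilde{K}_{\lambda,\mu'}$, where $\mu'$ is the weakly decreasing rearrangement of $\mu$ (the modified Kostka-Foulkes polynomial is unchanged by permuting $\mu$). Cocharge: for a permutation $w=w_1\cdots w_N$ of $\{1,\ldots,N\}$, put $cc(w,1)=0$ and, for $j\ge2$, $cc(w,j)=cc(w,j-1)+1$ if $j$ precedes (is to the left of) $j-1$ in $w$, and $cc(w,j)=cc(w,j-1)$ otherwise; set $cc(w)=\sum_{j=1}^N cc(w,j)$. For a word $w$ whose content $\mu$ is a partition, extract $\mu_1$ standard subwords: select the rightmost $1$; then select the rightmost $2$ lying to the left of the selected $1$, or, if there is none, the rightmost $2$ in the word; then select a $3$ relative to the selected $2$ in the same way, and so on until the largest entry in the word has been selected. The selected letters, in the order they appear in $w$, form $w^{(1)}$. Delete them and repeat on the remaining word to get $w^{(2)},\ldots,w^{(\mu_1)}$. Set $cc(w)=\sum_{i=1}^{\mu_1}cc(w^{(i)})$. For a tableau $T$ whose content is a partition, $cc(T)=cc(\mathrm{rw}(T))$, where the reading word $\mathrm{rw}(T)$ lists the entries of $T$ left to right across rows, starting with the bottom row and going up. *)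

theory Defs
  imports
    Complex_Main
    "HOL-Computational_Algebra.Computational_Algebra"
    "HOL-Combinatorics.Multiset_Permutations"
begin

subsection \<open>Conventions\<close>

text \<open>
  Tuples and partitions are lists of natural numbers, indexed from 0, so \<open>\<mu> ! i\<close> is the
  mathematical \<open>\<mu>\<close> with index \<open>i + 1\<close>. Partitions may have trailing zeros. A polynomial in the
  variables \<open>x 0, \<dots>, x (N - 1)\<close> is rendered by its values at real points, which determine it
  since the reals are infinite.
\<close>

definition partitions_of :: "nat \<Rightarrow> nat \<Rightarrow> nat list set" where
  "partitions_of N d = {\<nu>. length \<nu> = N \<and> sorted_wrt (\<ge>) \<nu> \<and> sum_list \<nu> = d}"

definition pad :: "nat \<Rightarrow> nat list \<Rightarrow> nat list" where
  "pad N \<mu> = \<mu> @ replicate (N - length \<mu>) 0"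


subsection \<open>Schur and Hall-Littlewood polynomials\<close>

text \<open>
  Semistandard Young tableaux of shape \<open>lam\<close> in English notation, given as the list of their rows
  from top to bottom, with the entries in \<open>{..<N}\<close> so that an entry is the index of a variable.
\<close>

definition ssyt :: "nat list \<Rightarrow> nat \<Rightarrow> nat list list set" where
  "ssyt lam N = {T. map length T = lam \<and>
     (\<forall>row \<in> set T. sorted row \<and> set row \<subseteq> {..<N}) \<and>
     (\<forall>i j. Suc i < length T \<and> j < length (T ! Suc i) \<and> j < length (T ! i) \<longrightarrow> T ! i ! j < T ! Suc i ! j)}"

definition schur :: "nat list \<Rightarrow> nat \<Rightarrow> (nat \<Rightarrow> real) \<Rightarrow> real" where
  "schur lam N x = (\<Sum>T \<in> ssyt lam N. prod_list (map x (concat T)))"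

text \<open>
  The Hall-Littlewood polynomial \<open>P\<close> of \<open>\<mu>\<close> in \<open>N = length \<mu>\<close> variables with parameter \<open>t\<close>: the sum
  over the cosets \<open>w\<close> of the stabilizer of \<open>\<mu>\<close> in the symmetric group on \<open>N\<close> letters of the images
  under \<open>w\<close> of the product of the monomial with exponent \<open>\<mu>\<close> and all factors
  \<open>(x i - t * x j) / (x i - x j)\<close> with \<open>\<mu> ! i > \<mu> ! j\<close> (Macdonald, Symmetric Functions and Hall
  Polynomials, Chapter III, (2.2)). The cosets correspond to the distinct rearrangements \<open>\<alpha>\<close>
  of \<open>\<mu>\<close>. The formula is meaningful at points with pairwise distinct coordinates.
\<close>

definition hall_littlewood :: "nat list \<Rightarrow> (nat \<Rightarrow> real) \<Rightarrow> real \<Rightarrow> real" where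
  "hall_littlewood \<mu> x t =
     (\<Sum>\<alpha> \<in> permutations_of_multiset (mset \<mu>).
        (\<Prod>i<length \<mu>. x i ^ (\<alpha> ! i)) *
        (\<Prod>(i, j) \<in> {(i, j). i < length \<mu> \<and> j < length \<mu> \<and> \<alpha> ! i > \<alpha> ! j}.
            (x i - t * x j) / (x i - x j)))"


subsection \<open>Kostka-Foulkes polynomials\<close>

text \<open>
  The family of coefficients expressing the Schur polynomial of \<open>lam\<close> in \<open>N\<close> variables in the
  Hall-Littlewood polynomials in \<open>N\<close> variables. The latter are linearly independent, so there is
  at most one such family.
\<close>

definition kostka_foulkes_family :: "nat \<Rightarrow> nat list \<Rightarrow> nat list \<Rightarrow> int poly" where
  "kostka_foulkes_family N lam = (THE K.
     (\<forall>\<nu>. \<nu> \<notin> partitions_of N (sum_list lam) \<longrightarrow> K \<nu> = 0) \<and>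
     (\<forall>(t :: real) (x :: nat \<Rightarrow> real). inj_on x {..<N} \<longrightarrow>
        schur lam N x =
          (\<Sum>\<nu> \<in> partitions_of N (sum_list lam).
             poly (map_poly of_int (K \<nu>)) t * hall_littlewood \<nu> x t)))"

text \<open>
  The number of variables must be at least the number of parts of \<open>lam\<close> and of \<open>\<mu>\<close>, and
  the coefficient does not depend on it beyond that: Schur and Hall-Littlewood polynomials are
  stable under setting the last variable to zero.
\<close>

definition kostka_foulkes :: "nat list \<Rightarrow> nat list \<Rightarrow> int poly" where
  "kostka_foulkes lam \<mu> =
     (let N = max (length lam) (length \<mu>) in kostka_foulkes_family N lam (pad N \<mu>))"

text \<open>The indeterminate \<open>q\<close>, in the field of rational functions in \<open>q\<close>.\<close>

definition qvar :: "int poly fract" where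
  "qvar = to_fract [:0, 1:]"

definition kappa :: "nat list \<Rightarrow> nat" where
  "kappa \<mu> = (\<Sum>i<length \<mu>. i * \<mu> ! i)"

text \<open>For a tuple \<open>\<mu>\<close> that is not weakly decreasing, its decreasing rearrangement is used.\<close>

definition modified_kostka_foulkes :: "nat list \<Rightarrow> nat list \<Rightarrow> int poly fract" where
  "modified_kostka_foulkes lam \<mu> =
     (let \<nu> = rev (sort \<mu>)
      in qvar ^ kappa \<nu> * poly (map_poly of_int (kostka_foulkes lam \<nu>)) (inverse qvar))"


subsection \<open>Gaussian binomial coefficients and the number beta\<close>

definition qbracket :: "'a::field \<Rightarrow> nat \<Rightarrow> 'a" where
  "qbracket q N = (q ^ N - 1) / (q - 1)"

definition qfactorial :: "'a::field \<Rightarrow> nat \<Rightarrow> 'a" where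
  "qfactorial q N = (\<Prod>i=1..N. qbracket q i)"

definition qbinomial :: "'a::field \<Rightarrow> int \<Rightarrow> int \<Rightarrow> 'a" where
  "qbinomial q N k =
     (if 0 \<le> k \<and> k \<le> N
      then qfactorial q (nat N) / (qfactorial q (nat k) * qfactorial q (nat (N - k)))
      else 0)"

text \<open>\<open>beta m n \<mu>\<close> is \<open>\<beta>(lam, \<mu>)\<close> for \<open>lam = m # replicate b n\<close>; it can be negative.\<close>

definition beta :: "nat \<Rightarrow> nat \<Rightarrow> nat list \<Rightarrow> int" where
  "beta m n \<mu> = int m - int n -
     (\<Sum>i<length \<mu>. if \<mu> ! i > n then int (\<mu> ! i) - int n else 0)"

end

theory Submission
  imports Defs
begin

text \<open>
  Put \<open>N = b + 2\<close>, \<open>k = m - n\<close> and \<open>y i = inverse (x i)\<close>, and let \<open>h\<close> denote complete homogeneous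
  symmetric polynomials in \<open>N\<close> variables. Both the Schur polynomial and the Hall-Littlewood
  polynomials are divided by the \<open>n\<close>-th power of the product of all variables. This turns the shape
  \<open>(m, n^b, 0)\<close> into the weight \<open>(k, 0^b, -n)\<close>, and exponents \<open>\<nu>\<close> into integer vectors \<open>\<nu> - n\<close>.

  On the Schur side, each of the \<open>n\<close> columns of length \<open>b + 1\<close> omits one of the \<open>N\<close> letters. Recording
  the omitted letters gives (\<open>schur_near_rectangle\<close>) the polynomial
  \<open>h k x * h n y - h (k - 1) x * h (n - 1) y\<close>.

  On the Hall-Littlewood side, weight an integer vector \<open>\<alpha>\<close> by its monomial, by the
  factors \<open>(x i - t * x j) / (x i - x j)\<close> for \<open>\<alpha> i > \<alpha> j\<close>, and by \<open>t\<close> to the total pairwise overlap of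
  the positive parts and of the negative parts of the entries. If the positive parts add up to \<open>p\<close> and the
  negative parts to \<open>r\<close>, the total weight is (\<open>signed_sum_eq\<close>) the sum over \<open>j\<close> of
  \<open>e j * h (p - j) x * h (r - j) y\<close>, where \<open>e j\<close> is the coefficient of \<open>z^j\<close> in the product of
  \<open>1 - t^i * z\<close> over \<open>i < N\<close>. Splitting off the set of negative coordinates reduces this to a
  rational identity over subsets, \<open>subset_identity\<close>, which is an interpolation argument.

  The Gaussian polynomials \<open>[b + j, j]\<close> in \<open>t\<close>, multiplied by \<open>t^j\<close>, have as generating function the inverse
  of the product of \<open>1 - t^i * z\<close> over \<open>1 \<le> i \<le> b + 1\<close>. Its product with the generating function of \<open>e\<close>
  is \<open>1 - z\<close>, and this is exactly the two-term shape of the Schur side. Hence the Schur polynomial expands in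
  Hall-Littlewood polynomials with coefficient \<open>t\<close> to the overlap plus \<open>\<beta>\<close>, times \<open>[b + \<beta>, \<beta>]\<close>.
  Hall-Littlewood polynomials are linearly independent (\<open>hl_terms_independent\<close>), so these
  coefficients are the Kostka-Foulkes polynomials; passing to \<open>1 / q\<close> and comparing exponents
  (\<open>kappa_eq\<close>) gives the statement.
\<close>

section \<open>A rational identity over subsets\<close>

definition cross_ratio :: "'a::field \<Rightarrow> ('b \<Rightarrow> 'a) \<Rightarrow> 'b set \<Rightarrow> 'b set \<Rightarrow> 'a" where
  "cross_ratio t y M A = (\<Prod>i\<in>M. \<Prod>j\<in>A. (y i - t * y j) / (y i - y j))"

lemma choose_two_add: "((a + b) choose 2) = (a choose 2) + (b choose 2) + a * b"
  using vandermonde[of a b 2] by (simp add: numeral_2_eq_2 field_simps)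

lemma sum_Pow_insert:
  assumes "finite S" "k \<notin> S"
  shows "(\<Sum>M\<in>Pow (insert k S). f M) = (\<Sum>M\<in>Pow S. f M + (f (insert k M) :: 'a::comm_monoid_add))"
proof -
  have "(\<Sum>M\<in>Pow (insert k S). f M) = (\<Sum>M\<in>Pow S. f M) + (\<Sum>M\<in>insert k ` Pow S. f M)"
    unfolding Pow_insert using assms by (intro sum.union_disjoint) auto
  also have "(\<Sum>M\<in>insert k ` Pow S. f M) = (\<Sum>M\<in>Pow S. f (insert k M))"
    using assms by (subst sum.reindex) (auto intro!: inj_onI simp: insert_ident)
  finally show ?thesis by (simp add: sum.distrib)
qed

text \<open>
  The factors of the term of \<open>M\<close> in \<open>subset_identity\<close> that do not involve the variable of the polynomial.
\<close>
definition subset_term :: "'a::field \<Rightarrow> 'a \<Rightarrow> ('b \<Rightarrow> 'a) \<Rightarrow> 'b set \<Rightarrow> 'b set \<Rightarrow> 'a" where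
  "subset_term t u y S M = t ^ (card M choose 2) * (\<Prod>i\<in>M. y i - u) * cross_ratio t y M (S - M)"

text \<open>
  As polynomials in \<open>v\<close>, both sides have degree at most \<open>card S\<close>, so it suffices to compare them at the
  \<open>card S + 1\<close> points \<open>0\<close> and \<open>1 / y k\<close>. At \<open>v = 0\<close> only the empty set contributes. At \<open>v = 1 / y k\<close> the
  sets without \<open>k\<close> drop out, and the factors \<open>(y k - t * y j) / (y k - y j)\<close> of the others turn
  \<open>1 - v * y j\<close> into \<open>1 - t * v * y j\<close>: what remains is the identity for \<open>S - {k}\<close> at the
  point \<open>t / y k\<close>, times \<open>1 - u / y k\<close>. The case \<open>u = 0\<close> handles vectors of one sign below,
  a free \<open>u\<close> those of both signs.
\<close>
lemma subset_identity:
  fixes y :: "'b \<Rightarrow> 'a::field"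
  assumes "finite S" "inj_on y S" "0 \<notin> y ` S"
  shows "(\<Sum>M\<in>Pow S. smult (subset_term t u y S M) (monom 1 (card M) * (\<Prod>i\<in>S - M. [:1, - y i:])))
    = (\<Prod>i<card S. [:1, - (t ^ i * u):])"
  using assms
proof (induction "card S" arbitrary: S)
  case 0
  then show ?case by (simp add: subset_term_def cross_ratio_def numeral_2_eq_2 flip: one_pCons)
next
  case (Suc N)
  let ?p = "\<lambda>S. \<Sum>M\<in>Pow S. smult (subset_term t u y S M) (monom 1 (card M) * (\<Prod>i\<in>S - M. [:1, - y i:]))"
  let ?q = "\<lambda>n. \<Prod>i<n. [:1, - (t ^ i * u):]"
  \<comment> \<open>The interpolation points.\<close>
  let ?A = "insert 0 ((\<lambda>k. inverse (y k)) ` S)"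
  have fin: "finite S" and inj: "inj_on y S" and nz: "\<And>i. i \<in> S \<Longrightarrow> y i \<noteq> 0"
    using Suc by auto
  have inj': "inj_on (\<lambda>k. inverse (y k)) S"
    using inj by (auto simp: inj_on_def)
  have cA: "card ?A = Suc (card S)"
    using fin nz inj' by (subst card_insert_disjoint) (auto simp: card_image)
  have deg: "degree (?p S) \<le> card S"
  proof (intro degree_sum_le)
    fix M assume M: "M \<in> Pow S"
    have "degree (\<Prod>i\<in>S - M. [:1, - y i:]) \<le> sum (degree \<circ> (\<lambda>i. [:1, - y i:])) (S - M)"
      using fin by (intro degree_prod_sum_le) auto
    also have "\<dots> \<le> (\<Sum>i\<in>S - M. 1)" by (intro sum_mono) simp
    finally have "degree (\<Prod>i\<in>S - M. [:1, - y i:]) \<le> card (S - M)" by simp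
    hence "degree (monom (1::'a) (card M) * (\<Prod>i\<in>S - M. [:1, - y i:])) \<le> card M + card (S - M)"
      by (intro order_trans[OF degree_mult_le] add_mono) (auto simp: degree_monom_eq)
    also have "\<dots> = card S"
      using M fin by (simp add: card_Diff_subset finite_subset card_mono)
    finally show "degree (smult (subset_term t u y S M) (monom 1 (card M) * (\<Prod>i\<in>S - M. [:1, - y i:]))) \<le> card S"
      using degree_smult_le order_trans by blast
  qed (use fin in auto)
  have "degree (?q (card S)) \<le> sum (degree \<circ> (\<lambda>i. [:1, - (t ^ i * u):])) {..<card S}"
    by (intro degree_prod_sum_le) auto
  also have "\<dots> \<le> (\<Sum>i<card S. 1)" by (intro sum_mono) simp
  finally have degq: "degree (?q (card S)) \<le> card S" by simp
  have "poly (?p S) v = poly (?q (card S)) v" if "v \<in> ?A" for v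
  proof (cases "v = 0")
    case True
    have "poly (?p S) 0 = (\<Sum>M\<in>Pow S. if M = {} then 1 else 0)"
      unfolding poly_sum by (intro sum.cong refl)
        (use fin in \<open>auto simp: poly_prod poly_monom subset_term_def cross_ratio_def zero_power numeral_2_eq_2 finite_subset card_gt_0_iff\<close>)
    also have "\<dots> = 1" using fin by simp
    finally show ?thesis using True by (simp add: poly_prod)
  next
    case False
    then obtain k where k: "k \<in> S" "v = inverse (y k)" using \<open>v \<in> ?A\<close> False by blast
    define R where "R = S - {k}"
    have R: "finite R" "k \<notin> R" "S = insert k R" "card R = N" "card S = Suc N" "inj_on y R" "0 \<notin> y ` R"
      using fin k Suc.hyps(2) Suc.prems by (auto simp: R_def inj_on_def)
    have yk: "y k \<noteq> 0" using nz k by auto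
    let ?f = "\<lambda>v S M. subset_term t u y S M * (v ^ card M * (\<Prod>i\<in>S - M. 1 - v * y i))"
    have pv: "poly (?p S) v = (\<Sum>M\<in>Pow S. ?f v S M)" for S v
      by (simp add: poly_sum poly_prod poly_monom)
    have "poly (?p S) v = (\<Sum>M\<in>Pow R. ?f v S M + ?f v S (insert k M))"
      unfolding pv R(3) by (rule sum_Pow_insert[OF R(1,2)])
    also have "\<dots> = (\<Sum>M\<in>Pow R. (1 - u * v) * ?f (t * v) R M)"
    proof (intro sum.cong refl)
      fix M assume M: "M \<in> Pow R"
      have finM: "finite M" and kM: "k \<notin> M" and SM: "S - M = insert k (R - M)"
        and SkM: "S - insert k M = R - M"
        using M R finite_subset by auto
      have "(\<Prod>i\<in>S - M. 1 - v * y i) = 0"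
        using R(1) k yk by (auto simp: SM)
      moreover have "?f v S (insert k M) = (1 - u * v) * ?f (t * v) R M"
      proof -
        have e1: "t ^ (card (insert k M) choose 2) = t ^ (card M choose 2) * t ^ card M"
          using finM kM choose_two_add[of "card M" 1] by (simp add: power_add numeral_2_eq_2)
        have e2: "cross_ratio t y (insert k M) (R - M)
            = (\<Prod>j\<in>R - M. (y k - t * y j) / (y k - y j)) * cross_ratio t y M (R - M)"
          using finM kM by (simp add: cross_ratio_def)
        have e3: "(\<Prod>j\<in>R - M. (y k - t * y j) / (y k - y j)) * (\<Prod>i\<in>R - M. 1 - v * y i)
            = (\<Prod>i\<in>R - M. 1 - t * v * y i)"
          unfolding prod.distrib[symmetric]
        proof (intro prod.cong refl)
          fix j assume j: "j \<in> R - M"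
          have "y k \<noteq> y j" using j inj k R by (auto simp: inj_on_def)
          thus "(y k - t * y j) / (y k - y j) * (1 - v * y j) = 1 - t * v * y j"
            using yk by (simp add: k(2) field_simps)
        qed
        have e4: "v * (y k - u) = 1 - u * v" using yk k(2) by (simp add: field_simps)
        have "?f v S (insert k M) = (v * (y k - u)) * (t ^ (card M choose 2) * (\<Prod>i\<in>M. y i - u) * cross_ratio t y M (R - M))
            * ((t * v) ^ card M * ((\<Prod>j\<in>R - M. (y k - t * y j) / (y k - y j)) * (\<Prod>i\<in>R - M. 1 - v * y i)))"
          unfolding subset_term_def e1 SkM e2 using finM kM by (simp add: power_mult_distrib mult_ac)
        thus ?thesis unfolding e3 e4 subset_term_def by (simp add: mult_ac)
      qed
      ultimately show "?f v S M + ?f v S (insert k M) = (1 - u * v) * ?f (t * v) R M" by simp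
    qed
    also have "\<dots> = (1 - u * v) * poly (?p R) (t * v)"
      unfolding pv by (simp add: sum_distrib_left)
    also have "?p R = ?q N"
      using Suc.hyps(1)[of R] R by simp
    also have "(1 - u * v) * poly (?q N) (t * v) = poly (?q (card S)) v"
      unfolding \<open>card S = Suc N\<close> by (subst prod.lessThan_Suc_shift) (simp add: poly_prod algebra_simps)
    finally show ?thesis .
  qed
  thus ?case
    using cA deg degq by (intro poly_eqI_degree[of ?A]) auto
qed

section \<open>Complete homogeneous symmetric polynomials\<close>

definition complete_fps :: "('b \<Rightarrow> 'a::field) \<Rightarrow> 'b set \<Rightarrow> 'a fps" where
  "complete_fps y S = (\<Prod>i\<in>S. inverse (1 - fps_const (y i) * fps_X))"

text \<open>
  The complete homogeneous symmetric polynomial of degree \<open>r\<close> in the variables indexed by \<open>S\<close>.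
\<close>
definition complete_sym :: "('b \<Rightarrow> 'a::field) \<Rightarrow> 'b set \<Rightarrow> nat \<Rightarrow> 'a" where
  "complete_sym y S r = fps_nth (complete_fps y S) r"

lemma complete_fps_cancel:
  assumes "finite S" "M \<subseteq> S"
  shows "(\<Prod>i\<in>S - M. 1 - fps_const (y i) * fps_X) * complete_fps y S = complete_fps y M"
proof -
  have "complete_fps y S = complete_fps y M * (\<Prod>i\<in>S - M. inverse (1 - fps_const (y i) * fps_X))"
    unfolding complete_fps_def by (subst prod.subset_diff[OF assms(2,1)]) (rule mult.commute)
  moreover have "(\<Prod>i\<in>S - M. 1 - fps_const (y i) * fps_X) * (\<Prod>i\<in>S - M. inverse (1 - fps_const (y i) * fps_X)) = 1"
    unfolding prod.distrib[symmetric] by (intro prod.neutral) (simp add: inverse_mult_eq_1')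
  ultimately show ?thesis by (metis (no_types, lifting) mult.assoc mult.commute mult_1)
qed

text \<open>
  Up to a sign and a power of \<open>t\<close>, these are Gaussian binomial coefficients (\<open>q\<close>-binomial theorem).
\<close>
definition euler_coeff :: "'a::field \<Rightarrow> nat \<Rightarrow> nat \<Rightarrow> 'a" where
  "euler_coeff t N j = coeff (\<Prod>i<N. [:1, - (t ^ i):]) j"

lemma coeff_euler_prod: "coeff (\<Prod>i<N. [:1, - (t ^ i * u):]) j = euler_coeff t N j * u ^ j"
proof (induction N arbitrary: j)
  case 0
  then show ?case by (cases j) (auto simp: euler_coeff_def)
next
  case (Suc N)
  have step: "coeff (p * [:1, - c:]) j = coeff p j - (if j = 0 then 0 else c * coeff p (j - 1))"
    for p :: "'a poly" and c j
    by (cases j) simp_all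
  have "coeff (\<Prod>i<Suc N. [:1, - (t ^ i * u):]) j
      = euler_coeff t N j * u ^ j - (if j = 0 then 0 else t ^ N * u * (euler_coeff t N (j - 1) * u ^ (j - 1)))"
    unfolding prod.lessThan_Suc step Suc.IH by simp
  also have "\<dots> = euler_coeff t (Suc N) j * u ^ j"
    unfolding euler_coeff_def prod.lessThan_Suc step by (cases j) (simp_all add: algebra_simps)
  finally show ?case .
qed

text \<open>
  Multiplying \<open>subset_identity\<close> by the generating function of the complete symmetric polynomials of
  \<open>S\<close> cancels the factors \<open>1 - y i * v\<close> with \<open>i\<close> outside \<open>M\<close>; this is the coefficient of \<open>v^r\<close>.
\<close>
lemma complete_sym_expansion:
  fixes y :: "'b \<Rightarrow> 'a::field"
  assumes "finite S" "inj_on y S" "0 \<notin> y ` S"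
  shows "(\<Sum>M | M \<subseteq> S \<and> card M \<le> r. subset_term t u y S M * complete_sym y M (r - card M))
    = (\<Sum>j\<le>r. euler_coeff t (card S) j * u ^ j * complete_sym y S (r - j))"
proof -
  have lin: "fps_of_poly [:1, - c:] = 1 - fps_const c * fps_X" for c :: 'a
    by (simp add: fps_of_poly_pCons)
  have "fps_of_poly (\<Sum>M\<in>Pow S. smult (subset_term t u y S M) (monom 1 (card M) * (\<Prod>i\<in>S - M. [:1, - y i:])))
      * complete_fps y S = (\<Sum>M\<in>Pow S. fps_const (subset_term t u y S M) * (fps_X ^ card M * complete_fps y M))"
    unfolding fps_of_poly_sum sum_distrib_right
  proof (intro sum.cong refl)
    fix M assume "M \<in> Pow S"
    hence *: "(\<Prod>i\<in>S - M. 1 - fps_const (y i) * fps_X) * complete_fps y S = complete_fps y M"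
      using assms(1) by (intro complete_fps_cancel) auto
    show "fps_of_poly (smult (subset_term t u y S M) (monom 1 (card M) * (\<Prod>i\<in>S - M. [:1, - y i:]))) * complete_fps y S
      = fps_const (subset_term t u y S M) * (fps_X ^ card M * complete_fps y M)"
      unfolding *[symmetric] by (simp only: fps_of_poly_smult fps_of_poly_mult fps_of_poly_prod lin fps_of_poly_monom'  mult_ac)
  qed
  hence "(\<Sum>M\<in>Pow S. fps_const (subset_term t u y S M) * (fps_X ^ card M * complete_fps y M))
      = fps_of_poly (\<Prod>i<card S. [:1, - (t ^ i * u):]) * complete_fps y S"
    unfolding subset_identity[OF assms] by simp
  hence "fps_nth (\<Sum>M\<in>Pow S. fps_const (subset_term t u y S M) * (fps_X ^ card M * complete_fps y M)) r
      = fps_nth (fps_of_poly (\<Prod>i<card S. [:1, - (t ^ i * u):]) * complete_fps y S) r"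
    by (rule arg_cong)
  moreover have "fps_nth (\<Sum>M\<in>Pow S. fps_const (subset_term t u y S M) * (fps_X ^ card M * complete_fps y M)) r
     = (\<Sum>M\<in>Pow S. if card M \<le> r then subset_term t u y S M * complete_sym y M (r - card M) else 0)"
    unfolding fps_sum_nth by (intro sum.cong) (auto simp: fps_X_power_mult_nth complete_sym_def)
  moreover have "\<dots> = (\<Sum>M | M \<subseteq> S \<and> card M \<le> r. subset_term t u y S M * complete_sym y M (r - card M))"
    using assms(1) by (subst sum.inter_filter[symmetric]) (auto intro!: sum.cong)
  moreover have "fps_nth (fps_of_poly (\<Prod>i<card S. [:1, - (t ^ i * u):]) * complete_fps y S) r
     = (\<Sum>j\<le>r. euler_coeff t (card S) j * u ^ j * complete_sym y S (r - j))"
    by (simp add: fps_mult_nth coeff_euler_prod complete_sym_def atLeast0AtMost)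
  ultimately show ?thesis by simp
qed

section \<open>Integer vectors split by their negative coordinates\<close>

definition signed_vectors :: "'b set \<Rightarrow> nat \<Rightarrow> nat \<Rightarrow> ('b \<Rightarrow> int) set" where
  "signed_vectors S p r = {\<alpha>. (\<forall>i. i \<notin> S \<longrightarrow> \<alpha> i = 0) \<and> (\<Sum>i\<in>S. nat (\<alpha> i)) = p \<and> (\<Sum>i\<in>S. nat (- \<alpha> i)) = r}"

definition order_factor :: "'a::field \<Rightarrow> ('b \<Rightarrow> 'a) \<Rightarrow> ('b \<Rightarrow> int) \<Rightarrow> 'b \<Rightarrow> 'b \<Rightarrow> 'a" where
  "order_factor t x \<alpha> i j = (if \<alpha> i > \<alpha> j then (x i - t * x j) / (x i - x j) else 1)"

text \<open>
  Each unordered pair is counted once, at \<open>i < j\<close>. For a partition, the minima of its pairs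
  of parts add up to the sum of the parts weighted by their positions.
\<close>
definition overlap_factor :: "'a::field \<Rightarrow> ('b::linorder \<Rightarrow> int) \<Rightarrow> 'b \<Rightarrow> 'b \<Rightarrow> 'a" where
  "overlap_factor t \<alpha> i j = (if i < j then t ^ (nat (min (\<alpha> i) (\<alpha> j)) + nat (min (- \<alpha> i) (- \<alpha> j))) else 1)"

definition signed_weight :: "'a::field \<Rightarrow> ('b::linorder \<Rightarrow> 'a) \<Rightarrow> 'b set \<Rightarrow> ('b \<Rightarrow> int) \<Rightarrow> 'a" where
  "signed_weight t x S \<alpha> = (\<Prod>i\<in>S. x i powi \<alpha> i) *
     (\<Prod>i\<in>S. \<Prod>j\<in>S. order_factor t x \<alpha> i j * overlap_factor t \<alpha> i j)"

definition signed_sum :: "'a::field \<Rightarrow> ('b::linorder \<Rightarrow> 'a) \<Rightarrow> 'b set \<Rightarrow> nat \<Rightarrow> nat \<Rightarrow> 'a" where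
  "signed_sum t x S p r = (\<Sum>\<alpha>\<in>signed_vectors S p r. signed_weight t x S \<alpha>)"

lemma finite_signed_vectors:
  fixes S :: "'b set"
  assumes "finite S" shows "finite (signed_vectors S p r)"
proof -
  have "signed_vectors S p r \<subseteq> {\<alpha>. \<forall>i. (i \<in> S \<longrightarrow> \<alpha> i \<in> {- int r..int p}) \<and> (i \<notin> S \<longrightarrow> \<alpha> i = 0)}"
  proof
    fix \<alpha> assume \<alpha>: "\<alpha> \<in> signed_vectors S p r"
    have "\<alpha> i \<in> {- int r..int p}" if "i \<in> S" for i
    proof -
      have "(\<Sum>i\<in>S. nat (\<alpha> i)) = p" "(\<Sum>i\<in>S. nat (- \<alpha> i)) = r"
        using \<alpha> by (simp_all add: signed_vectors_def)
      moreover have "nat (\<alpha> i) \<le> (\<Sum>i\<in>S. nat (\<alpha> i))" "nat (- \<alpha> i) \<le> (\<Sum>i\<in>S. nat (- \<alpha> i))"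
        using assms that by (auto intro: member_le_sum)
      ultimately have "nat (\<alpha> i) \<le> p" "nat (- \<alpha> i) \<le> r" by simp_all
      thus ?thesis by auto
    qed
    thus "\<alpha> \<in> {\<alpha>. \<forall>i. (i \<in> S \<longrightarrow> \<alpha> i \<in> {- int r..int p}) \<and> (i \<notin> S \<longrightarrow> \<alpha> i = 0)}"
      using \<alpha> by (auto simp: signed_vectors_def)
  qed
  moreover have "finite {\<alpha> :: 'b \<Rightarrow> int. \<forall>i. (i \<in> S \<longrightarrow> \<alpha> i \<in> {- int r..int p}) \<and> (i \<notin> S \<longrightarrow> \<alpha> i = 0)}"
    by (intro finite_set_of_finite_funs assms) auto
  ultimately show ?thesis by (rule finite_subset)
qed

lemma signed_vectors_nonneg:
  assumes "finite S" "\<alpha> \<in> signed_vectors S p 0" shows "\<alpha> i \<ge> 0"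
  using assms by (cases "i \<in> S") (auto simp: signed_vectors_def)

lemma signed_vectors_nonpos:
  assumes "finite S" "\<alpha> \<in> signed_vectors S 0 r" shows "\<alpha> i \<le> 0"
  using assms by (cases "i \<in> S") (auto simp: signed_vectors_def)

lemma signed_vectors_0_0:
  assumes "finite S" shows "signed_vectors S 0 0 = {\<lambda>_. 0}"
proof -
  have "\<alpha> = (\<lambda>_. 0)" if "\<alpha> \<in> signed_vectors S 0 0" for \<alpha>
    using signed_vectors_nonneg[OF assms that] signed_vectors_nonpos[OF assms that]
    by (intro ext antisym) blast+
  moreover have "(\<lambda>_. 0) \<in> signed_vectors S 0 0" by (simp add: signed_vectors_def)
  ultimately show ?thesis by blast
qed

lemma signed_sum_0_0 [simp]: "finite S \<Longrightarrow> signed_sum t x S 0 0 = 1"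
  by (simp add: signed_sum_def signed_vectors_0_0 signed_weight_def order_factor_def overlap_factor_def cong: if_cong)

lemma signed_sum_empty: "signed_sum t x {} 0 r = (if r = 0 then 1 else 0)"
  using signed_sum_0_0[of "{}" t x] by (auto simp: signed_sum_def signed_vectors_def)

text \<open>
  The shift by \<open>1\<close> lets \<open>\<gamma>\<close> range over all nonpositive vectors on \<open>M\<close> while \<open>M\<close> stays exactly the
  set of negative coordinates.
\<close>
definition splice_neg :: "'b set \<Rightarrow> ('b \<Rightarrow> int) \<Rightarrow> ('b \<Rightarrow> int) \<Rightarrow> 'b \<Rightarrow> int" where
  "splice_neg M \<gamma> \<delta> i = (if i \<in> M then \<gamma> i - 1 else \<delta> i)"

lemma splice_neg_mem:
  assumes "finite S" "M \<subseteq> S" "card M \<le> r"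
    and \<gamma>: "\<gamma> \<in> signed_vectors M 0 (r - card M)" and \<delta>: "\<delta> \<in> signed_vectors (S - M) p 0"
  shows "splice_neg M \<gamma> \<delta> \<in> signed_vectors S p r"
proof -
  have fin: "finite M" "finite (S - M)" using assms finite_subset by auto
  have g: "\<gamma> i \<le> 0" for i using signed_vectors_nonpos[OF fin(1) \<gamma>] .
  have d: "\<delta> i \<ge> 0" for i using signed_vectors_nonneg[OF fin(2) \<delta>] .
  have split: "(\<Sum>i\<in>S. f i) = (\<Sum>i\<in>S - M. f i) + (\<Sum>i\<in>M. f i)" for f :: "'a \<Rightarrow> nat"
    using assms by (simp add: sum.subset_diff)
  have "(\<Sum>i\<in>S. nat (splice_neg M \<gamma> \<delta> i)) = (\<Sum>i\<in>S - M. nat (\<delta> i)) + (\<Sum>i\<in>M. 0)"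
    unfolding split by (intro arg_cong2[where f = "(+)"] sum.cong) (use g in \<open>auto simp: splice_neg_def intro: order_trans[of _ 0]\<close>)
  moreover have "(\<Sum>i\<in>S. nat (- splice_neg M \<gamma> \<delta> i)) = (\<Sum>i\<in>S - M. 0) + (\<Sum>i\<in>M. nat (- \<gamma> i) + 1)"
    unfolding split
  proof (intro arg_cong2[where f = "(+)"] sum.cong refl)
    fix i assume "i \<in> M" thus "nat (- splice_neg M \<gamma> \<delta> i) = nat (- \<gamma> i) + 1"
      using g[of i] by (simp add: splice_neg_def)
  qed (use d in \<open>auto simp: splice_neg_def\<close>)
  moreover have "(\<Sum>i\<in>S - M. nat (\<delta> i)) = p" "(\<Sum>i\<in>M. nat (- \<gamma> i)) = r - card M"
    using \<gamma> \<delta> by (auto simp: signed_vectors_def)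
  ultimately have "(\<Sum>i\<in>S. nat (splice_neg M \<gamma> \<delta> i)) = p" "(\<Sum>i\<in>S. nat (- splice_neg M \<gamma> \<delta> i)) = r"
    using assms(3) by (simp_all only: sum.distrib) auto
  moreover have "\<forall>i. i \<notin> S \<longrightarrow> splice_neg M \<gamma> \<delta> i = 0"
    using \<delta> assms(2) by (auto simp: signed_vectors_def splice_neg_def)
  ultimately show ?thesis by (simp add: signed_vectors_def)
qed

text \<open>
  A vector is the same as its set \<open>M\<close> of negative coordinates together with a nonpositive vector on \<open>M\<close>
  and a nonnegative vector on the complement.
\<close>
lemma sum_signed_vectors_split:
  fixes F :: "('b \<Rightarrow> int) \<Rightarrow> 'a::comm_monoid_add"
  assumes "finite S"
  shows "(\<Sum>\<alpha>\<in>signed_vectors S p r. F \<alpha>) =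
    (\<Sum>M | M \<subseteq> S \<and> card M \<le> r. \<Sum>\<gamma>\<in>signed_vectors M 0 (r - card M).
       \<Sum>\<delta>\<in>signed_vectors (S - M) p 0. F (splice_neg M \<gamma> \<delta>))"
proof -
  let ?I = "{M. M \<subseteq> S \<and> card M \<le> r}"
  let ?J = "\<lambda>M. signed_vectors M 0 (r - card M) \<times> signed_vectors (S - M) p 0"
  have finM: "finite M" if "M \<in> ?I" for M using that assms finite_subset by auto
  have finI: "finite ?I" using assms by auto
  have finJ: "\<forall>M\<in>?I. finite (?J M)"
    using finM assms by (intro ballI finite_cartesian_product finite_signed_vectors) simp_all
  let ?j = "\<lambda>\<alpha>. ({i\<in>S. \<alpha> i < 0}, \<lambda>i. if \<alpha> i < 0 then \<alpha> i + 1 else 0, \<lambda>i. if \<alpha> i < 0 then 0 else \<alpha> i)"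
  have "(\<Sum>\<alpha>\<in>signed_vectors S p r. F \<alpha>) = (\<Sum>(M, \<gamma>, \<delta>)\<in>Sigma ?I ?J. F (splice_neg M \<gamma> \<delta>))"
  proof (rule sum.reindex_bij_witness[where i = "\<lambda>(M, \<gamma>, \<delta>). splice_neg M \<gamma> \<delta>" and j = ?j])
    fix \<alpha> assume \<alpha>: "\<alpha> \<in> signed_vectors S p r"
    let ?M = "{i\<in>S. \<alpha> i < 0}"
    have 0: "\<alpha> i = 0" if "i \<notin> S" for i using \<alpha> that by (auto simp: signed_vectors_def)
    have inS: "i \<in> S" if "\<alpha> i < 0" for i using 0[of i] that by (cases "i \<in> S") auto
    show e: "(\<lambda>(M, \<gamma>, \<delta>). splice_neg M \<gamma> \<delta>) (?j \<alpha>) = \<alpha>"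
      using 0 by (force simp: splice_neg_def fun_eq_iff)
    thus "(case ?j \<alpha> of (M, \<gamma>, \<delta>) \<Rightarrow> F (splice_neg M \<gamma> \<delta>)) = F \<alpha>" by simp
    have "(\<Sum>i\<in>S. nat (\<alpha> i)) = (\<Sum>i\<in>S - ?M. nat (if \<alpha> i < 0 then 0 else \<alpha> i))"
      using assms by (intro sum.mono_neutral_cong_right) auto
    hence p: "(\<Sum>i\<in>S - ?M. nat (if \<alpha> i < 0 then 0 else \<alpha> i)) = p"
      using \<alpha> by (simp add: signed_vectors_def)
    have "(\<Sum>i\<in>S. nat (- \<alpha> i)) = (\<Sum>i\<in>?M. nat (- (if \<alpha> i < 0 then \<alpha> i + 1 else 0)) + 1)"
      using assms by (intro sum.mono_neutral_cong_right) auto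
    hence r: "(\<Sum>i\<in>?M. nat (- (if \<alpha> i < 0 then \<alpha> i + 1 else 0))) + card ?M = r"
      using \<alpha> unfolding sum.distrib by (simp add: signed_vectors_def)
    have z: "(\<Sum>i\<in>?M. nat (if \<alpha> i < 0 then \<alpha> i + 1 else 0)) = 0"
      "(\<Sum>i\<in>S - ?M. nat (- (if \<alpha> i < 0 then 0 else \<alpha> i))) = 0"
      by (auto intro!: sum.neutral)
    have "(\<Sum>i\<in>?M. nat (- (if \<alpha> i < 0 then \<alpha> i + 1 else 0))) = r - card ?M"
      using r by linarith
    hence "(\<lambda>i. if \<alpha> i < 0 then \<alpha> i + 1 else 0) \<in> signed_vectors ?M 0 (r - card ?M)"
      unfolding signed_vectors_def mem_Collect_eq using z(1) inS by (intro conjI) auto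
    moreover have "(\<lambda>i. if \<alpha> i < 0 then 0 else \<alpha> i) \<in> signed_vectors (S - ?M) p 0"
      unfolding signed_vectors_def mem_Collect_eq using z(2) p 0 by (intro conjI) auto
    moreover have "?M \<in> ?I" using r by auto
    ultimately show "?j \<alpha> \<in> Sigma ?I ?J" by (intro SigmaI)
  next
    fix m assume m: "m \<in> Sigma ?I ?J"
    obtain M \<gamma> \<delta> where m_eq: "m = (M, \<gamma>, \<delta>)" by (cases m) auto
    have MI: "M \<in> ?I" and \<gamma>: "\<gamma> \<in> signed_vectors M 0 (r - card M)"
      and \<delta>: "\<delta> \<in> signed_vectors (S - M) p 0"
      using m unfolding m_eq by blast+
    have M: "M \<in> ?I" "finite M" "finite (S - M)" using MI finM[OF MI] assms by simp_all
    show "(\<lambda>(M, \<gamma>, \<delta>). splice_neg M \<gamma> \<delta>) m \<in> signed_vectors S p r"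
      unfolding m_eq prod.case using M(1) by (intro splice_neg_mem assms \<gamma> \<delta>) auto
    have g: "\<gamma> i \<le> 0" for i using signed_vectors_nonpos[OF M(2) \<gamma>] .
    have d: "\<delta> i \<ge> 0" for i using signed_vectors_nonneg[OF M(3) \<delta>] .
    have g0: "\<gamma> i = 0" if "i \<notin> M" for i using \<gamma> that by (auto simp: signed_vectors_def)
    have d0: "\<delta> i = 0" if "i \<in> M" for i using \<delta> that by (auto simp: signed_vectors_def)
    have neg: "splice_neg M \<gamma> \<delta> i < 0 \<longleftrightarrow> i \<in> M" for i
      using g[of i] d[of i] by (auto simp: splice_neg_def)
    show "?j ((\<lambda>(M, \<gamma>, \<delta>). splice_neg M \<gamma> \<delta>) m) = m"
      unfolding m_eq prod.case neg using M(1) g0 d0 by (auto simp: splice_neg_def fun_eq_iff)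
  qed
  also have "\<dots> = (\<Sum>M\<in>?I. \<Sum>(\<gamma>, \<delta>)\<in>?J M. F (splice_neg M \<gamma> \<delta>))"
    by (rule sum.Sigma[OF finI finJ, symmetric])
  also have "\<dots> = (\<Sum>M\<in>?I. \<Sum>\<gamma>\<in>signed_vectors M 0 (r - card M).
       \<Sum>\<delta>\<in>signed_vectors (S - M) p 0. F (splice_neg M \<gamma> \<delta>))"
    unfolding sum.cartesian_product ..
  finally show ?thesis .
qed

lemma prod_pairs_less_const:
  fixes t :: "'a::comm_monoid_mult" and M :: "'b::linorder set"
  assumes "finite M"
  shows "(\<Prod>i\<in>M. \<Prod>j\<in>M. if i < j then t else 1) = t ^ (card M choose 2)"
  using assms
proof (induction M rule: finite_induct)
  case empty
  then show ?case by (simp add: numeral_2_eq_2)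
next
  case (insert k M)
  have "(\<Prod>i\<in>insert k M. \<Prod>j\<in>insert k M. if i < j then t else 1)
     = (\<Prod>j\<in>M. if k < j then t else 1) * ((\<Prod>i\<in>M. if i < k then t else 1) * (\<Prod>i\<in>M. \<Prod>j\<in>M. if i < j then t else 1))"
    using insert by (simp add: prod.distrib mult_ac)
  also have "\<dots> = (\<Prod>j\<in>M. (if k < j then t else 1) * (if j < k then t else 1)) * t ^ (card M choose 2)"
    unfolding insert.IH prod.distrib by (rule mult.assoc[symmetric])
  also have "(\<Prod>j\<in>M. (if k < j then t else 1) * (if j < k then t else 1)) = (\<Prod>j\<in>M. t)"
    using insert.hyps by (intro prod.cong) (auto simp: not_less)
  also have "\<dots> * t ^ (card M choose 2) = t ^ (card (insert k M) choose 2)"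
    using insert.hyps by (simp add: numeral_2_eq_2 power_add mult.commute)
  finally show ?case .
qed

lemma prod_pairs_split:
  fixes f :: "'b \<Rightarrow> 'b \<Rightarrow> 'a::comm_monoid_mult"
  assumes "finite S" "M \<subseteq> S"
  shows "(\<Prod>i\<in>S. \<Prod>j\<in>S. f i j) = (\<Prod>i\<in>M. \<Prod>j\<in>M. f i j) * (\<Prod>i\<in>S - M. \<Prod>j\<in>S - M. f i j)
    * (\<Prod>i\<in>S - M. \<Prod>j\<in>M. f i j * f j i)"
proof -
  have split: "(\<Prod>i\<in>S. g i) = (\<Prod>i\<in>S - M. g i) * (\<Prod>i\<in>M. g i)" for g :: "'b \<Rightarrow> 'a"
    using assms by (simp add: prod.subset_diff)
  have "(\<Prod>i\<in>M. \<Prod>j\<in>S - M. f i j) = (\<Prod>i\<in>S - M. \<Prod>j\<in>M. f j i)" by (rule prod.swap)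
  thus ?thesis unfolding split prod.distrib by (simp add: mult_ac)
qed

text \<open>
  Coordinates in \<open>M\<close> are smaller than the others and have no overlap with them, so the mixed pairs contribute only
  order factors. Lowering all coordinates in \<open>M\<close> by \<open>1\<close> raises the overlap of each pair in \<open>M\<close> by \<open>1\<close>.
\<close>
lemma signed_weight_splice:
  fixes x :: "'b::linorder \<Rightarrow> 'a::field"
  assumes "finite S" "M \<subseteq> S" "\<forall>i\<in>S. x i \<noteq> 0"
    and g: "\<And>i. \<gamma> i \<le> 0" and d: "\<And>i. \<delta> i \<ge> 0"
  shows "signed_weight t x S (splice_neg M \<gamma> \<delta>) =
    t ^ (card M choose 2) * (\<Prod>i\<in>M. inverse (x i)) * (\<Prod>i\<in>S - M. \<Prod>j\<in>M. (x i - t * x j) / (x i - x j))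
    * (signed_weight t x M \<gamma> * signed_weight t x (S - M) \<delta>)"
proof -
  let ?\<alpha> = "splice_neg M \<gamma> \<delta>"
  let ?f = "\<lambda>\<alpha> i j. order_factor t x \<alpha> i j * overlap_factor t \<alpha> i j"
  have fin: "finite M" using assms(1,2) finite_subset by blast
  have "(\<Prod>i\<in>S. x i powi ?\<alpha> i) = (\<Prod>i\<in>S - M. x i powi \<delta> i) * (\<Prod>i\<in>M. x i powi \<gamma> i * inverse (x i))"
    unfolding prod.subset_diff[OF assms(2,1)]
  proof (intro arg_cong2[where f = "(*)"] prod.cong refl)
    fix i assume "i \<in> M"
    thus "x i powi ?\<alpha> i = x i powi \<gamma> i * inverse (x i)"
      using assms by (auto simp: splice_neg_def power_int_diff field_simps)
  qed (auto simp: splice_neg_def)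
  moreover have "(\<Prod>i\<in>M. \<Prod>j\<in>M. ?f ?\<alpha> i j) = (\<Prod>i\<in>M. \<Prod>j\<in>M. ?f \<gamma> i j) * t ^ (card M choose 2)"
    unfolding prod_pairs_less_const[OF fin, symmetric] prod.distrib[symmetric]
  proof (intro prod.cong refl)
    fix i j assume ij: "i \<in> M" "j \<in> M"
    have *: "nat (min (\<gamma> i - 1) (\<gamma> j - 1)) = nat (min (\<gamma> i) (\<gamma> j))"
      "nat (min (1 - \<gamma> i) (1 - \<gamma> j)) = Suc (nat (min (- \<gamma> i) (- \<gamma> j)))"
      using g[of i] g[of j] by linarith+
    show "?f ?\<alpha> i j = ?f \<gamma> i j * (if i < j then t else 1)"
      using ij by (simp add: splice_neg_def order_factor_def overlap_factor_def *)
  qed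
  moreover have "(\<Prod>i\<in>S - M. \<Prod>j\<in>S - M. ?f ?\<alpha> i j) = (\<Prod>i\<in>S - M. \<Prod>j\<in>S - M. ?f \<delta> i j)"
    by (intro prod.cong refl) (simp add: splice_neg_def order_factor_def overlap_factor_def)
  moreover have "(\<Prod>i\<in>S - M. \<Prod>j\<in>M. ?f ?\<alpha> i j * ?f ?\<alpha> j i) = (\<Prod>i\<in>S - M. \<Prod>j\<in>M. (x i - t * x j) / (x i - x j))"
  proof (intro prod.cong refl)
    fix i j assume ij: "i \<in> S - M" "j \<in> M"
    have "\<delta> i > \<gamma> j - 1" "nat (min (\<delta> i) (\<gamma> j - 1)) = 0" "nat (min (- \<delta> i) (1 - \<gamma> j)) = 0"
       "nat (min (\<gamma> j - 1) (\<delta> i)) = 0" "nat (min (1 - \<gamma> j) (- \<delta> i)) = 0"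
      using g[of j] d[of i] by linarith+
    thus "?f ?\<alpha> i j * ?f ?\<alpha> j i = (x i - t * x j) / (x i - x j)"
      using ij by (simp add: splice_neg_def order_factor_def overlap_factor_def)
  qed
  ultimately show ?thesis
    unfolding signed_weight_def prod_pairs_split[OF assms(1,2)] prod.distrib[of _ _ M] by (simp only: mult_ac)
qed

lemma signed_sum_split:
  fixes x :: "'b::linorder \<Rightarrow> 'a::field"
  assumes "finite S" "\<forall>i\<in>S. x i \<noteq> 0"
  shows "signed_sum t x S p r = (\<Sum>M | M \<subseteq> S \<and> card M \<le> r.
    t ^ (card M choose 2) * (\<Prod>i\<in>M. inverse (x i)) * (\<Prod>i\<in>S - M. \<Prod>j\<in>M. (x i - t * x j) / (x i - x j))
    * (signed_sum t x M 0 (r - card M) * signed_sum t x (S - M) p 0))"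
  unfolding signed_sum_def sum_signed_vectors_split[OF assms(1)]
proof (intro sum.cong refl)
  fix M assume "M \<in> {M. M \<subseteq> S \<and> card M \<le> r}"
  hence M: "M \<subseteq> S" "finite M" "finite (S - M)" using assms finite_subset by auto
  let ?c = "t ^ (card M choose 2) * (\<Prod>i\<in>M. inverse (x i)) * (\<Prod>i\<in>S - M. \<Prod>j\<in>M. (x i - t * x j) / (x i - x j))"
  have "(\<Sum>\<gamma>\<in>signed_vectors M 0 (r - card M). \<Sum>\<delta>\<in>signed_vectors (S - M) p 0. signed_weight t x S (splice_neg M \<gamma> \<delta>))
    = (\<Sum>\<gamma>\<in>signed_vectors M 0 (r - card M). \<Sum>\<delta>\<in>signed_vectors (S - M) p 0.
         ?c * (signed_weight t x M \<gamma> * signed_weight t x (S - M) \<delta>))"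
    using signed_vectors_nonpos[OF M(2)] signed_vectors_nonneg[OF M(3)]
    by (intro sum.cong refl signed_weight_splice assms M(1)) auto
  thus "(\<Sum>\<gamma>\<in>signed_vectors M 0 (r - card M). \<Sum>\<delta>\<in>signed_vectors (S - M) p 0. signed_weight t x S (splice_neg M \<gamma> \<delta>))
    = ?c * (sum (signed_weight t x M) (signed_vectors M 0 (r - card M)) * sum (signed_weight t x (S - M)) (signed_vectors (S - M) p 0))"
    unfolding sum_product unfolding sum_distrib_left .
qed

lemma overlap_factor_uminus: "overlap_factor t (\<lambda>i. - \<alpha> i) = overlap_factor t \<alpha>"
  by (simp add: overlap_factor_def fun_eq_iff add.commute)

text \<open>
  Negating all vectors exchanges positive and negative parts and inverts the variables.
\<close>
lemma signed_sum_inverse: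
  fixes x :: "'b::linorder \<Rightarrow> 'a::field"
  assumes "\<forall>i\<in>S. x i \<noteq> 0"
  shows "signed_sum t (\<lambda>i. inverse (x i)) S p r = signed_sum t x S r p"
  unfolding signed_sum_def
proof (rule sum.reindex_bij_witness[where i = "\<lambda>\<alpha> i. - \<alpha> i" and j = "\<lambda>\<alpha> i. - \<alpha> i"])
  fix \<alpha> :: "'b \<Rightarrow> int"
  have "(\<Prod>i\<in>S. \<Prod>j\<in>S. order_factor t x (\<lambda>i. - \<alpha> i) i j) = (\<Prod>i\<in>S. \<Prod>j\<in>S. order_factor t (\<lambda>i. inverse (x i)) \<alpha> j i)"
  proof (intro prod.cong refl)
    fix i j assume ij: "i \<in> S" "j \<in> S"
    have "(inverse (x j) - t * inverse (x i)) / (inverse (x j) - inverse (x i)) = (x i - t * x j) / (x i - x j)"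
    proof (cases "x i = x j")
      case False
      thus ?thesis using bspec[OF assms ij(1)] bspec[OF assms ij(2)] by (simp add: divide_simps)
    qed simp
    thus "order_factor t x (\<lambda>i. - \<alpha> i) i j = order_factor t (\<lambda>i. inverse (x i)) \<alpha> j i"
      by (simp add: order_factor_def)
  qed
  also have "\<dots> = (\<Prod>i\<in>S. \<Prod>j\<in>S. order_factor t (\<lambda>i. inverse (x i)) \<alpha> i j)" by (rule prod.swap)
  finally show "signed_weight t x S (\<lambda>i. - \<alpha> i) = signed_weight t (\<lambda>i. inverse (x i)) S \<alpha>"
    by (simp add: signed_weight_def prod.distrib overlap_factor_uminus power_int_minus power_int_inverse)
qed (auto simp: signed_vectors_def)

section \<open>The total weight of integer vectors\<close>

lemma euler_coeff_0 [simp]: "euler_coeff t N 0 = 1"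
  by (induction N) (auto simp: euler_coeff_def coeff_mult)

lemma complete_sym_0 [simp]: "complete_sym y S 0 = 1"
proof (cases "finite S")
  case True
  thus ?thesis by (induction S rule: finite_induct) (auto simp: complete_sym_def complete_fps_def)
qed (simp add: complete_sym_def complete_fps_def)

lemma complete_sym_empty: "complete_sym y {} r = (if r = 0 then 1 else 0)"
  by (simp add: complete_sym_def complete_fps_def)

lemma cross_ratio_inverse:
  fixes x :: "'b \<Rightarrow> 'a::field"
  assumes "\<forall>i\<in>M \<union> A. x i \<noteq> 0"
  shows "cross_ratio t (\<lambda>i. inverse (x i)) M A = (\<Prod>i\<in>A. \<Prod>j\<in>M. (x i - t * x j) / (x i - x j))"
  unfolding cross_ratio_def prod.swap[of _ A M]
proof (intro prod.cong refl)
  fix i j assume ij: "i \<in> M" "j \<in> A"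
  show "(inverse (x i) - t * inverse (x j)) / (inverse (x i) - inverse (x j)) = (x j - t * x i) / (x j - x i)"
  proof (cases "x i = x j")
    case False
    thus ?thesis using assms ij by (simp add: divide_simps)
  qed simp
qed

lemma signed_sum_split_subset_term:
  fixes x :: "'b::linorder \<Rightarrow> 'a::field"
  assumes "finite S" "\<forall>i\<in>S. x i \<noteq> 0"
  shows "signed_sum t x S p r = (\<Sum>M | M \<subseteq> S \<and> card M \<le> r.
    subset_term t 0 (\<lambda>i. inverse (x i)) S M * (signed_sum t x M 0 (r - card M) * signed_sum t x (S - M) p 0))"
  unfolding signed_sum_split[OF assms]
proof (intro sum.cong refl)
  fix M assume M: "M \<in> {M. M \<subseteq> S \<and> card M \<le> r}"
  have "cross_ratio t (\<lambda>i. inverse (x i)) M (S - M) = (\<Prod>i\<in>S - M. \<Prod>j\<in>M. (x i - t * x j) / (x i - x j))"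
    using assms(2) M by (intro cross_ratio_inverse) auto
  thus "t ^ (card M choose 2) * (\<Prod>i\<in>M. inverse (x i)) * (\<Prod>i\<in>S - M. \<Prod>j\<in>M. (x i - t * x j) / (x i - x j)) *
      (signed_sum t x M 0 (r - card M) * signed_sum t x (S - M) p 0)
     = subset_term t 0 (\<lambda>i. inverse (x i)) S M * (signed_sum t x M 0 (r - card M) * signed_sum t x (S - M) p 0)"
    by (simp add: subset_term_def)
qed

text \<open>
  The splitting of \<open>signed_sum_split\<close> expresses the left-hand side through smaller \<open>r\<close>;
  \<open>complete_sym_expansion\<close> at \<open>u = 0\<close> says that complete symmetric polynomials satisfy the same recursion.
  This is the classical expansion of \<open>h\<close> in Hall-Littlewood polynomials.
\<close>
lemma signed_sum_nonpos:
  fixes x :: "'b::linorder \<Rightarrow> 'a::field"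
  assumes "finite S" "inj_on x S" "\<forall>i\<in>S. x i \<noteq> 0"
  shows "signed_sum t x S 0 r = complete_sym (\<lambda>i. inverse (x i)) S r"
  using assms
proof (induction r arbitrary: S rule: less_induct)
  case (less r)
  let ?y = "\<lambda>i. inverse (x i)"
  have "signed_sum t x S 0 r = (\<Sum>M | M \<subseteq> S \<and> card M \<le> r. subset_term t 0 ?y S M * complete_sym ?y M (r - card M))"
    unfolding signed_sum_split_subset_term[OF less.prems(1,3)]
  proof (intro sum.cong refl)
    fix M assume "M \<in> {M. M \<subseteq> S \<and> card M \<le> r}"
    hence M: "M \<subseteq> S" "card M \<le> r" "finite M" using less.prems finite_subset by auto
    have "signed_sum t x M 0 (r - card M) = complete_sym ?y M (r - card M)"
    proof (cases "M = {} \<or> r = 0")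
      case True
      thus ?thesis using M by (auto simp: signed_sum_empty complete_sym_empty)
    next
      case False
      hence "r - card M < r" using M by (simp add: card_gt_0_iff)
      thus ?thesis using M less.prems by (intro less.IH) (auto intro: inj_on_subset)
    qed
    thus "subset_term t 0 ?y S M * (signed_sum t x M 0 (r - card M) * signed_sum t x (S - M) 0 0)
      = subset_term t 0 ?y S M * complete_sym ?y M (r - card M)"
      using less.prems by simp
  qed
  also have "\<dots> = (\<Sum>j\<le>r. euler_coeff t (card S) j * 0 ^ j * complete_sym ?y S (r - j))"
    using less.prems by (intro complete_sym_expansion) (auto simp: inj_on_def)
  also have "\<dots> = (\<Sum>j\<le>r. if j = 0 then complete_sym ?y S r else 0)"
    by (intro sum.cong) auto
  finally show ?case by simp
qed

lemma signed_sum_nonneg: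
  fixes x :: "'b::linorder \<Rightarrow> 'a::field"
  assumes "finite S" "inj_on x S" "\<forall>i\<in>S. x i \<noteq> 0"
  shows "signed_sum t x S p 0 = complete_sym x S p"
proof -
  have "signed_sum t x S p 0 = signed_sum t (\<lambda>i. inverse (x i)) S 0 p"
    using assms by (simp add: signed_sum_inverse)
  also have "\<dots> = complete_sym x S p"
    using assms by (subst signed_sum_nonpos) (auto simp: inj_on_def)
  finally show ?thesis .
qed

text \<open>
  With \<open>A = S - M\<close>, the splitting turns the left-hand side into a sum over \<open>M\<close> of multiples of
  \<open>complete_sym x A p\<close>. Here \<open>complete_fps x A\<close> is \<open>complete_fps x S\<close> times the product of \<open>1 - x i * u\<close>
  over \<open>M\<close>, and \<open>complete_sym_expansion\<close>, read as an identity of polynomials in \<open>u\<close>, evaluates the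
  sum of these products.
\<close>
lemma signed_sum_eq:
  fixes x :: "'b::linorder \<Rightarrow> 'a::field_char_0"
  assumes "finite S" "inj_on x S" and nz: "\<forall>i\<in>S. x i \<noteq> 0"
  shows "signed_sum t x S p r = (\<Sum>j\<le>min p r. euler_coeff t (card S) j *
    complete_sym x S (p - j) * complete_sym (\<lambda>i. inverse (x i)) S (r - j))"
proof -
  let ?y = "\<lambda>i. inverse (x i)"
  let ?I = "{M. M \<subseteq> S \<and> card M \<le> r}"
  define a where "a M = subset_term t 0 ?y S M * complete_sym ?y M (r - card M)" for M
  define c where "c j = euler_coeff t (card S) j * complete_sym ?y S (r - j)" for j
  have "poly (\<Sum>M\<in>?I. smult (a M) (\<Prod>i\<in>M. [:1, - x i:])) = poly (\<Sum>j\<le>r. monom (c j) j)"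
  proof
    fix u
    have "(\<Sum>M\<in>?I. a M * (\<Prod>i\<in>M. 1 - u * x i)) = (\<Sum>M\<in>?I. subset_term t u ?y S M * complete_sym ?y M (r - card M))"
    proof (intro sum.cong refl)
      fix M assume "M \<in> ?I"
      hence "(\<Prod>i\<in>M. ?y i) * (\<Prod>i\<in>M. 1 - u * x i) = (\<Prod>i\<in>M. ?y i - u)"
        unfolding prod.distrib[symmetric] using nz by (intro prod.cong) (auto simp: field_simps)
      thus "a M * (\<Prod>i\<in>M. 1 - u * x i) = subset_term t u ?y S M * complete_sym ?y M (r - card M)"
        unfolding a_def subset_term_def by (simp add: mult_ac)
    qed
    also have "\<dots> = (\<Sum>j\<le>r. euler_coeff t (card S) j * u ^ j * complete_sym ?y S (r - j))"
      using assms by (intro complete_sym_expansion) (auto simp: inj_on_def)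
    finally show "poly (\<Sum>M\<in>?I. smult (a M) (\<Prod>i\<in>M. [:1, - x i:])) u = poly (\<Sum>j\<le>r. monom (c j) j) u"
      by (simp add: poly_sum poly_prod poly_monom c_def mult_ac)
  qed
  hence "(\<Sum>M\<in>?I. smult (a M) (\<Prod>i\<in>M. [:1, - x i:])) = (\<Sum>j\<le>r. monom (c j) j)"
    by (simp only: poly_eq_poly_eq_iff)
  hence eq: "fps_of_poly (\<Sum>M\<in>?I. smult (a M) (\<Prod>i\<in>M. [:1, - x i:])) * complete_fps x S
      = fps_of_poly (\<Sum>j\<le>r. monom (c j) j) * complete_fps x S"
    by simp
  have lin: "fps_of_poly [:1, - c:] = 1 - fps_const c * fps_X" for c :: 'a
    by (simp add: fps_of_poly_pCons)
  have "fps_of_poly (\<Sum>M\<in>?I. smult (a M) (\<Prod>i\<in>M. [:1, - x i:])) * complete_fps x S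
      = (\<Sum>M\<in>?I. fps_const (a M) * complete_fps x (S - M))"
    unfolding fps_of_poly_sum sum_distrib_right
  proof (intro sum.cong refl)
    fix M assume "M \<in> ?I"
    hence *: "(\<Prod>i\<in>S - (S - M). 1 - fps_const (x i) * fps_X) * complete_fps x S = complete_fps x (S - M)"
      using assms(1) by (intro complete_fps_cancel) auto
    moreover have "S - (S - M) = M" using \<open>M \<in> ?I\<close> by auto
    ultimately show "fps_of_poly (smult (a M) (\<Prod>i\<in>M. [:1, - x i:])) * complete_fps x S = fps_const (a M) * complete_fps x (S - M)"
      by (simp only: fps_of_poly_smult fps_of_poly_prod lin mult.assoc)
  qed
  hence "(\<Sum>M\<in>?I. a M * complete_sym x (S - M) p) = fps_nth (fps_of_poly (\<Sum>j\<le>r. monom (c j) j) * complete_fps x S) p"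
    unfolding eq by (simp add: fps_sum_nth complete_sym_def)
  also have "\<dots> = (\<Sum>j\<le>r. fps_nth (fps_const (c j) * (fps_X ^ j * complete_fps x S)) p)"
    unfolding fps_of_poly_sum sum_distrib_right fps_sum_nth fps_of_poly_monom mult.assoc ..
  also have "\<dots> = (\<Sum>j\<le>r. if j \<le> p then c j * complete_sym x S (p - j) else 0)"
    by (intro sum.cong) (auto simp: fps_X_power_mult_nth complete_sym_def)
  also have "\<dots> = (\<Sum>j\<le>min p r. c j * complete_sym x S (p - j))"
    by (intro sum.mono_neutral_cong_right) auto
  finally have "(\<Sum>M\<in>?I. a M * complete_sym x (S - M) p) = (\<Sum>j\<le>min p r. c j * complete_sym x S (p - j))" .
  moreover have "signed_sum t x S p r = (\<Sum>M\<in>?I. a M * complete_sym x (S - M) p)"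
    unfolding signed_sum_split_subset_term[OF assms(1) nz]
  proof (intro sum.cong refl)
    fix M assume "M \<in> ?I"
    hence M: "M \<subseteq> S" "finite M" using assms finite_subset by auto
    have "signed_sum t x M 0 (r - card M) = complete_sym ?y M (r - card M)"
      using M assms by (intro signed_sum_nonpos) (auto intro: inj_on_subset)
    moreover have "signed_sum t x (S - M) p 0 = complete_sym x (S - M) p"
      using M assms by (intro signed_sum_nonneg) (auto intro: inj_on_subset)
    ultimately show "subset_term t 0 ?y S M * (signed_sum t x M 0 (r - card M) * signed_sum t x (S - M) p 0)
       = a M * complete_sym x (S - M) p" by (simp add: a_def)
  qed
  ultimately show ?thesis by (simp add: c_def mult_ac)
qed

section \<open>The Schur polynomial of a rectangle with a longer first row\<close>

definition sorted_words :: "nat \<Rightarrow> nat \<Rightarrow> nat \<Rightarrow> nat list set" where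
  "sorted_words l N k = {w. sorted w \<and> set w \<subseteq> {l..<N} \<and> length w = k}"

lemma finite_sorted_words: "finite (sorted_words l N k)"
  by (rule finite_subset[OF _ finite_lists_length_eq[of "{l..<N}" k]]) (auto simp: sorted_words_def)

lemma sorted_words_0: "sorted_words l N 0 = {[]}"
  by (auto simp: sorted_words_def)

lemma sorted_words_Suc:
  assumes "l < N"
  shows "sorted_words l N (Suc k) = (#) l ` sorted_words l N k \<union> sorted_words (Suc l) N (Suc k)"
proof (intro set_eqI iffI)
  fix w assume w: "w \<in> sorted_words l N (Suc k)"
  then obtain a v where v: "w = a # v" by (cases w) (auto simp: sorted_words_def)
  show "w \<in> (#) l ` sorted_words l N k \<union> sorted_words (Suc l) N (Suc k)"
  proof (cases "a = l")
    case True
    thus ?thesis using w v by (auto simp: sorted_words_def)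
  next
    case False
    hence "Suc l \<le> a" using w v by (auto simp: sorted_words_def)
    thus ?thesis using w v by (force simp: sorted_words_def)
  qed
next
  fix w assume "w \<in> (#) l ` sorted_words l N k \<union> sorted_words (Suc l) N (Suc k)"
  thus "w \<in> sorted_words l N (Suc k)"
    using assms by (force simp: sorted_words_def)
qed

lemma complete_sym_Suc:
  fixes x :: "nat \<Rightarrow> 'a::field"
  assumes "l < N"
  shows "complete_sym x {l..<N} (Suc k) = x l * complete_sym x {l..<N} k + complete_sym x {Suc l..<N} (Suc k)"
proof -
  have "{l..<N} - {Suc l..<N} = {l}" using assms by auto
  hence "(1 - fps_const (x l) * fps_X) * complete_fps x {l..<N} = complete_fps x {Suc l..<N}"
    using complete_fps_cancel[of "{l..<N}" "{Suc l..<N}" x] by auto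
  hence "fps_nth ((1 - fps_const (x l) * fps_X) * complete_fps x {l..<N}) (Suc k) = complete_sym x {Suc l..<N} (Suc k)"
    by (simp add: complete_sym_def)
  thus ?thesis by (simp add: complete_sym_def left_diff_distrib mult.assoc diff_eq_eq add.commute)
qed

lemma sum_sorted_words:
  fixes x :: "nat \<Rightarrow> 'a::field"
  shows "(\<Sum>w\<in>sorted_words l N k. prod_list (map x w)) = complete_sym x {l..<N} k"
proof (induction "N - l + k" arbitrary: l k rule: less_induct)
  case less
  show ?case
  proof (cases k)
    case 0
    thus ?thesis by (simp add: sorted_words_0)
  next
    case (Suc k')
    show ?thesis
    proof (cases "l < N")
      case False
      have "sorted_words l N k = {}" using False Suc by (auto simp: sorted_words_def)
      thus ?thesis using False Suc by (simp add: complete_sym_empty)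
    next
      case True
      have "(\<Sum>w\<in>sorted_words l N k. prod_list (map x w))
         = (\<Sum>w\<in>(#) l ` sorted_words l N k'. prod_list (map x w)) + (\<Sum>w\<in>sorted_words (Suc l) N (Suc k'). prod_list (map x w))"
        unfolding Suc sorted_words_Suc[OF True]
        by (intro sum.union_disjoint finite_imageI finite_sorted_words) (auto simp: sorted_words_def)
      also have "(\<Sum>w\<in>(#) l ` sorted_words l N k'. prod_list (map x w)) = x l * complete_sym x {l..<N} k'"
        using less[of l k'] Suc by (subst sum.reindex) (auto simp: sum_distrib_left[symmetric])
      also have "(\<Sum>w\<in>sorted_words (Suc l) N (Suc k'). prod_list (map x w)) = complete_sym x {Suc l..<N} (Suc k')"
        using less[of "Suc l" "Suc k'"] Suc True by auto
      finally show ?thesis unfolding Suc complete_sym_Suc[OF True] .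
    qed
  qed
qed

text \<open>
  The \<open>i\<close>-th entry of the column that consists of all letters except \<open>c\<close>.
\<close>
definition skip :: "nat \<Rightarrow> nat \<Rightarrow> nat" where
  "skip c i = (if i < c then i else Suc i)"

lemma skip_antimono: "c \<le> c' \<Longrightarrow> skip c' i \<le> skip c i"
  by (auto simp: skip_def)

lemma skip_less: "skip c i < skip c (Suc i)"
  by (auto simp: skip_def)

lemma skip_inject:
  assumes "\<And>i. i \<le> b \<Longrightarrow> skip c i = skip c' i" "c \<le> Suc b" "c' \<le> Suc b"
  shows "c = c'"
proof (rule ccontr)
  assume "c \<noteq> c'"
  thus False using assms(1)[of c] assms(1)[of c'] assms(2,3)
    by (cases c c' rule: linorder_cases) (auto simp: skip_def)
qed

lemma prod_skip:
  fixes x :: "nat \<Rightarrow> 'a::field"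
  assumes "c \<le> Suc b" "x c \<noteq> 0"
  shows "(\<Prod>i\<le>b. x (skip c i)) = (\<Prod>i<b + 2. x i) * inverse (x c)"
proof -
  have "(\<Prod>i\<le>b. x (skip c i)) = (\<Prod>i\<in>{..<b + 2} - {c}. x i)"
    by (rule prod.reindex_bij_witness[where j = "skip c" and i = "\<lambda>l. if l < c then l else l - 1"])
      (use assms in \<open>auto simp: skip_def split: if_splits\<close>)
  moreover have "(\<Prod>i<b + 2. x i) = x c * (\<Prod>i\<in>{..<b + 2} - {c}. x i)"
    using assms(1) by (intro prod.remove) auto
  ultimately show ?thesis using assms(2) by simp
qed

text \<open>
  The list \<open>d\<close> holds the letters omitted by the first columns. They decrease from left to right, hence
  the reversal. The list \<open>w\<close> is the part of the first row that sticks out of the rectangle.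
\<close>
definition tableau_of :: "nat \<Rightarrow> nat list \<times> nat list \<Rightarrow> nat list list" where
  "tableau_of b = (\<lambda>(d, w). (map (\<lambda>c. skip c 0) (rev d) @ w) # map (\<lambda>i. map (\<lambda>c. skip c i) (rev d)) [1..<Suc b])"

text \<open>
  The first row of the tableau is weakly increasing unless the last full column omits \<open>0\<close>, and so starts
  with \<open>1\<close>, while \<open>w\<close> starts with \<open>0\<close>.
\<close>
definition column_pairs :: "nat \<Rightarrow> nat \<Rightarrow> nat \<Rightarrow> (nat list \<times> nat list) set" where
  "column_pairs b n k = {(d, w). d \<in> sorted_words 0 (b + 2) n \<and> w \<in> sorted_words 0 (b + 2) k \<and> \<not> (0 \<in> set d \<and> 0 \<in> set w)}"

lemma tableau_of_nth:
  assumes "i \<le> b" "j < length d"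
  shows "tableau_of b (d, w) ! i ! j = skip (rev d ! j) i"
  using assms by (cases i) (auto simp: tableau_of_def nth_append simp del: upt_Suc)

lemma length_tableau_of: "length (tableau_of b (d, w)) = Suc b"
  by (simp add: tableau_of_def)

lemma sorted_map_skip_rev:
  assumes "sorted d" shows "sorted (map (\<lambda>c. skip c i) (rev d))"
  unfolding rev_map[symmetric] sorted_wrt_rev sorted_wrt_map
  using assms by (rule sorted_wrt_mono_rel[rotated]) (auto intro: skip_antimono)

lemma tableau_of_mem:
  assumes "(d, w) \<in> column_pairs b n k"
  shows "tableau_of b (d, w) \<in> ssyt ((n + k) # replicate b n) (b + 2)"
proof -
  have d: "sorted d" "set d \<subseteq> {0..<b + 2}" "length d = n"
    and w: "sorted w" "set w \<subseteq> {0..<b + 2}" "length w = k" and dw: "\<not> (0 \<in> set d \<and> 0 \<in> set w)"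
    using assms by (auto simp: column_pairs_def sorted_words_def)
  let ?T = "tableau_of b (d, w)"
  have len: "map length ?T = (n + k) # replicate b n"
    using d w by (simp add: tableau_of_def map_replicate_const comp_def del: upt_Suc)
  have "sorted row \<and> set row \<subseteq> {..<b + 2}" if "row \<in> set ?T" for row
  proof -
    have skip_lt: "skip c i < b + 2" if "i < Suc b" for c i using that by (auto simp: skip_def)
    consider "row = map (\<lambda>c. skip c 0) (rev d) @ w" | i where "i < Suc b" "row = map (\<lambda>c. skip c i) (rev d)"
      using \<open>row \<in> set ?T\<close> by (auto simp: tableau_of_def simp del: upt_Suc)
    thus ?thesis
    proof cases
      case 1
      have "skip c 0 \<le> v" if "c \<in> set d" "v \<in> set w" for c v
        using that dw by (cases "c = 0"; cases "v = 0") (auto simp: skip_def)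
      thus ?thesis using 1 d w skip_lt[of 0] sorted_map_skip_rev[OF d(1), of 0] by (auto simp: sorted_append)
    next
      case 2
      thus ?thesis using skip_lt sorted_map_skip_rev[OF d(1)] by auto
    qed
  qed
  moreover have "?T ! i ! j < ?T ! Suc i ! j"
    if "Suc i < length ?T" "j < length (?T ! Suc i)" for i j
  proof -
    have "Suc i \<le> b" using that(1) by (simp add: length_tableau_of)
    moreover have "map length ?T ! Suc i = n" using \<open>Suc i \<le> b\<close> by (simp add: len)
    hence "length (?T ! Suc i) = n" using that(1) by simp
    ultimately show ?thesis using that(2) d(3) by (simp add: tableau_of_nth skip_less)
  qed
  ultimately show ?thesis using len by (simp add: ssyt_def)
qed

lemma inj_on_tableau_of: "inj_on (tableau_of b) (column_pairs b n k)"
proof (rule inj_onI, clarify)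
  fix d w d' w'
  assume dw: "(d, w) \<in> column_pairs b n k" "(d', w') \<in> column_pairs b n k"
    and eq: "tableau_of b (d, w) = tableau_of b (d', w')"
  have len: "length d = n" "length d' = n" and sub: "set d \<subseteq> {0..<b + 2}" "set d' \<subseteq> {0..<b + 2}"
    using dw by (auto simp: column_pairs_def sorted_words_def)
  have "w = w'" using eq len by (auto simp: tableau_of_def)
  have "rev d ! j = rev d' ! j" if "j < n" for j
  proof (rule skip_inject[of b])
    show "skip (rev d ! j) i = skip (rev d' ! j) i" if "i \<le> b" for i
      using that eq len \<open>j < n\<close> by (metis tableau_of_nth)
    have "rev d ! j \<in> set d" "rev d' ! j \<in> set d'" using that len by (metis length_rev nth_mem set_rev)+
    thus "rev d ! j \<le> Suc b" "rev d' ! j \<le> Suc b" using sub by auto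
  qed
  hence "rev d = rev d'" using len by (intro nth_equalityI) auto
  thus "d = d' \<and> w = w'" using \<open>w = w'\<close> by simp
qed

text \<open>
  A strictly increasing column of length \<open>b + 1\<close> with entries at most \<open>b + 1\<close> has entry \<open>i\<close> or \<open>i + 1\<close> in row
  \<open>i\<close>, and once it has left the diagonal it never returns. The omitted letter is the row where it leaves.
\<close>
lemma ssyt_near_rectangle:
  assumes T: "T \<in> ssyt ((n + k) # replicate b n) (b + 2)"
  shows "T \<in> tableau_of b ` column_pairs b n k"
proof -
  have len: "map length T = (n + k) # replicate b n"
    and rows: "\<And>row. row \<in> set T \<Longrightarrow> sorted row \<and> set row \<subseteq> {..<b + 2}"
    and col: "\<And>i j. Suc i < length T \<Longrightarrow> j < length (T ! Suc i) \<Longrightarrow> j < length (T ! i) \<Longrightarrow> T ! i ! j < T ! Suc i ! j"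
    using T by (auto simp: ssyt_def)
  have lenT: "length T = Suc b" using arg_cong[OF len, of length] by simp
  have leni: "length (T ! i) = (if i = 0 then n + k else n)" if "i \<le> b" for i
  proof -
    have "length (T ! i) = map length T ! i" using that lenT by simp
    thus ?thesis using that by (cases i) (simp_all add: len)
  qed
  have step: "T ! i ! j < T ! Suc i ! j" if "i < b" "j < n" for i j
    using that lenT leni[of i] leni[of "Suc i"] by (intro col) auto
  have bound: "T ! b ! j \<le> Suc b" if "j < n" for j
  proof -
    have "T ! b ! j \<in> set (T ! b)" using that leni[of b] by (auto split: if_splits)
    moreover have "T ! b \<in> set T" using lenT by simp
    ultimately show ?thesis using rows[of "T ! b"] by auto
  qed
  have mono: "T ! i ! j + l \<le> T ! (i + l) ! j" if "i + l \<le> b" "j < n" for i l j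
    using that
  proof (induction l)
    case (Suc l)
    thus ?case using step[of "i + l" j] by simp
  qed simp
  have lower: "i \<le> T ! i ! j" if "i \<le> b" "j < n" for i j
    using mono[of 0 i j] that by simp
  have upper: "T ! i ! j \<le> Suc i" if "i \<le> b" "j < n" for i j
    using mono[of i "b - i" j] bound[of j] that by simp
  \<comment> \<open>The letter omitted by column \<open>j\<close>; it is \<open>b + 1\<close> if the column never leaves the diagonal.\<close>
  define c where "c j = (LEAST i. i = Suc b \<or> T ! i ! j \<noteq> i)" for j
  have c_le: "c j \<le> Suc b" for j unfolding c_def by (rule Least_le) simp
  have entry: "T ! i ! j = skip (c j) i" if "i \<le> b" "j < n" for i j
  proof (cases "i < c j")
    case True
    thus ?thesis using not_less_Least[of i "\<lambda>i. i = Suc b \<or> T ! i ! j \<noteq> i"] by (auto simp: c_def skip_def)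
  next
    case False
    have "c j = Suc b \<or> T ! (c j) ! j \<noteq> c j"
      unfolding c_def by (rule LeastI[of _ "Suc b"]) simp
    hence "Suc (c j) \<le> T ! (c j) ! j" using False that lower[of "c j" j] by auto
    hence "Suc i \<le> T ! i ! j" using mono[of "c j" "i - c j" j] False that by simp
    thus ?thesis using upper[OF that] False by (simp add: skip_def)
  qed
  have row_sorted: "sorted (T ! i)" if "i \<le> b" for i
    using rows[of "T ! i"] that lenT by simp
  have c_anti: "c j' \<le> c j" if "j \<le> j'" "j' < n" for j j'
  proof (rule ccontr)
    assume *: "\<not> c j' \<le> c j"
    hence cb: "c j \<le> b" using c_le[of j'] by simp
    have "T ! (c j) ! j \<le> T ! (c j) ! j'"
      using row_sorted[OF cb] that leni[OF cb] by (intro sorted_nth_mono) auto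
    thus False using entry[OF cb, of j] entry[OF cb, of j'] that * by (simp add: skip_def)
  qed
  define d where "d = rev (map c [0..<n])"
  define w where "w = drop n (T ! 0)"
  have rd: "rev d ! j = c j" if "j < n" for j using that by (simp add: d_def)
  have "sorted d"
    unfolding d_def sorted_wrt_rev by (auto simp: sorted_wrt_iff_nth_less intro!: c_anti)
  moreover have "set d \<subseteq> {0..<b + 2}" using c_le by (auto simp: d_def less_Suc_eq_le)
  ultimately have "d \<in> sorted_words 0 (b + 2) n" by (simp add: sorted_words_def d_def)
  moreover have "w \<in> sorted_words 0 (b + 2) k"
    using row_sorted[of 0] rows[of "T ! 0"] lenT leni[of 0]
    by (auto simp: sorted_words_def w_def dest!: in_set_dropD)
  moreover have "\<not> (0 \<in> set d \<and> 0 \<in> set w)"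
  proof
    assume 0: "0 \<in> set d \<and> 0 \<in> set w"
    then obtain j where j: "j < n" "c j = 0" by (auto simp: d_def)
    obtain i where i: "i < k" "T ! 0 ! (n + i) = 0"
      using 0 leni[of 0] by (auto simp: w_def in_set_conv_nth)
    have "T ! 0 ! j \<le> T ! 0 ! (n + i)"
      using row_sorted[of 0] leni[of 0] i j by (intro sorted_nth_mono) auto
    thus False using entry[of 0 j] i j by (simp add: skip_def)
  qed
  moreover have "tableau_of b (d, w) = T"
  proof (rule nth_equalityI)
    show "length (tableau_of b (d, w)) = length T" by (simp add: length_tableau_of lenT)
    fix i assume "i < length (tableau_of b (d, w))"
    hence i: "i \<le> b" by (simp add: length_tableau_of)
    have len_d: "length d = n" by (simp add: d_def)
    show "tableau_of b (d, w) ! i = T ! i"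
    proof (cases "i = 0")
      case True
      have "take n (T ! 0) = map (\<lambda>c. skip c 0) (rev d)"
        using leni[of 0] len_d rd entry[of 0] by (intro nth_equalityI) auto
      hence "T ! 0 = map (\<lambda>c. skip c 0) (rev d) @ w" by (metis append_take_drop_id w_def)
      thus ?thesis using True by (simp add: tableau_of_def)
    next
      case False
      hence l: "tableau_of b (d, w) ! i = map (\<lambda>c. skip c i) (rev d)"
        using i by (cases i) (auto simp: tableau_of_def simp del: upt_Suc)
      show ?thesis unfolding l using False leni[OF i] len_d rd entry[OF i] by (intro nth_equalityI) auto
    qed
  qed
  ultimately show ?thesis by (force simp: column_pairs_def)
qed

lemma prod_list_map_mult:
  "prod_list (map (\<lambda>c. f c * g c) cs) = prod_list (map f cs) * (prod_list (map g cs) :: 'a::comm_monoid_mult)"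
  by (induction cs) (auto simp: mult_ac)

lemma prod_list_concat_map:
  fixes x :: "'b \<Rightarrow> 'a::comm_monoid_mult"
  shows "prod_list (map x (concat (map (\<lambda>i. map (h i) cs) is))) = prod_list (map (\<lambda>c. prod_list (map (\<lambda>i. x (h i c)) is)) cs)"
proof (induction "is")
  case Nil
  show ?case by (induction cs) auto
next
  case (Cons i "is")
  thus ?case by (simp add: prod_list_map_mult comp_def)
qed

lemma prod_list_const_mult: "prod_list (map (\<lambda>c. a * f c) cs) = a ^ length cs * (prod_list (map f cs) :: 'a::comm_monoid_mult)"
  by (induction cs) (auto simp: mult_ac)

lemma tableau_of_weight:
  fixes x :: "nat \<Rightarrow> real"
  assumes "(d, w) \<in> column_pairs b n k" "\<forall>i<b + 2. x i \<noteq> 0"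
  shows "prod_list (map x (concat (tableau_of b (d, w)))) =
    (\<Prod>i<b + 2. x i) ^ n * (prod_list (map (\<lambda>i. inverse (x i)) d) * prod_list (map x w))"
proof -
  have d: "set d \<subseteq> {0..<b + 2}" "length d = n"
    using assms by (auto simp: column_pairs_def sorted_words_def)
  have "prod_list (map x (concat (tableau_of b (d, w)))) =
     prod_list (map x (concat (map (\<lambda>i. map (\<lambda>c. skip c i) (rev d)) [0..<Suc b]))) * prod_list (map x w)"
    unfolding tableau_of_def prod.case by (subst upt_conv_Cons[of 0]) (simp_all add: mult_ac del: upt_Suc)
  also have "prod_list (map x (concat (map (\<lambda>i. map (\<lambda>c. skip c i) (rev d)) [0..<Suc b])))
     = prod_list (rev (map (\<lambda>c. prod_list (map (\<lambda>i. x (skip c i)) [0..<Suc b])) d))"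
    unfolding prod_list_concat_map rev_map ..
  also have "\<dots> = prod_list (map (\<lambda>c. prod_list (map (\<lambda>i. x (skip c i)) [0..<Suc b])) d)"
    by (rule prod_list.rev)
  also have "map (\<lambda>c. prod_list (map (\<lambda>i. x (skip c i)) [0..<Suc b])) d = map (\<lambda>c. (\<Prod>i<b + 2. x i) * inverse (x c)) d"
  proof (rule map_cong[OF refl])
    fix c assume "c \<in> set d"
    hence "c \<le> Suc b" "x c \<noteq> 0" using d assms(2) by auto
    moreover have "prod_list (map (\<lambda>i. x (skip c i)) [0..<Suc b]) = (\<Prod>i\<le>b. x (skip c i))"
      by (subst prod.distinct_set_conv_list[symmetric]) (auto simp: atLeast0LessThan lessThan_Suc_atMost simp del: upt_Suc)
    ultimately show "prod_list (map (\<lambda>i. x (skip c i)) [0..<Suc b]) = (\<Prod>i<b + 2. x i) * inverse (x c)"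
      by (simp add: prod_skip del: upt_Suc)
  qed
  finally show ?thesis unfolding prod_list_const_mult d(2) by (simp only: mult.assoc)
qed

lemma sum_sorted_words_0_mem:
  fixes x :: "nat \<Rightarrow> 'a::field"
  assumes "0 < N"
  shows "(\<Sum>w | w \<in> sorted_words 0 N k \<and> 0 \<in> set w. prod_list (map x w)) = (if k = 0 then 0 else x 0 * complete_sym x {0..<N} (k - 1))"
proof (cases k)
  case 0
  hence "{w. w \<in> sorted_words 0 N k \<and> 0 \<in> set w} = {}" by (auto simp: sorted_words_0)
  thus ?thesis using 0 by (simp only: sum.empty if_True simp_thms)
next
  case (Suc k')
  have "{w. w \<in> sorted_words 0 N k \<and> 0 \<in> set w} = (#) 0 ` sorted_words 0 N k'"
    unfolding Suc sorted_words_Suc[OF assms] by (auto simp: sorted_words_def)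
  thus ?thesis using Suc by (simp add: sum.reindex sum_sorted_words[symmetric] sum_distrib_left)
qed

text \<open>
  The pairs in which both lists contain \<open>0\<close> are removed from all pairs. Both lists then start with \<open>0\<close>, and
  deleting these two letters changes the weight by \<open>y 0 * x 0 = 1\<close>.
\<close>
lemma schur_near_rectangle:
  fixes x :: "nat \<Rightarrow> real"
  assumes nz: "\<forall>i<b + 2. x i \<noteq> 0"
  defines "y \<equiv> \<lambda>i. inverse (x i)"
  shows "schur ((n + k) # replicate b n) (b + 2) x = (\<Prod>i<b + 2. x i) ^ n *
    (complete_sym x {..<b + 2} k * complete_sym y {..<b + 2} n
      - (if k = 0 \<or> n = 0 then 0 else complete_sym x {..<b + 2} (k - 1) * complete_sym y {..<b + 2} (n - 1)))"
proof -
  let ?W = "sorted_words 0 (b + 2)"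
  let ?Z = "\<lambda>k. {w. w \<in> ?W k \<and> 0 \<in> set w}"
  let ?f = "\<lambda>(d, w). prod_list (map y d) * prod_list (map x w)"
  have "ssyt ((n + k) # replicate b n) (b + 2) = tableau_of b ` column_pairs b n k"
    using ssyt_near_rectangle tableau_of_mem by (force simp: image_iff)
  hence "schur ((n + k) # replicate b n) (b + 2) x = (\<Sum>p\<in>column_pairs b n k. prod_list (map x (concat (tableau_of b p))))"
    unfolding schur_def by (simp add: sum.reindex[OF inj_on_tableau_of])
  also have "\<dots> = (\<Sum>p\<in>column_pairs b n k. (\<Prod>i<b + 2. x i) ^ n * ?f p)"
    using tableau_of_weight[OF _ nz] by (intro sum.cong) (auto simp: y_def)
  also have "\<dots> = (\<Prod>i<b + 2. x i) ^ n * (\<Sum>p\<in>column_pairs b n k. ?f p)"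
    by (rule sum_distrib_left[symmetric])
  also have "column_pairs b n k = (?W n \<times> ?W k) - (?Z n \<times> ?Z k)"
    unfolding column_pairs_def by (simp add: set_eq_iff) blast
  also have "(\<Sum>p\<in>(?W n \<times> ?W k) - (?Z n \<times> ?Z k). ?f p) = (\<Sum>p\<in>?W n \<times> ?W k. ?f p) - (\<Sum>p\<in>?Z n \<times> ?Z k. ?f p)"
  proof (rule sum_diff)
    show "finite (?W n \<times> ?W k)" by (intro finite_cartesian_product finite_sorted_words)
    show "?Z n \<times> ?Z k \<subseteq> ?W n \<times> ?W k" by auto
  qed
  also have "(\<Sum>p\<in>?W n \<times> ?W k. ?f p) = complete_sym y {0..<b + 2} n * complete_sym x {0..<b + 2} k"
    unfolding sum_sorted_words[symmetric] sum_product sum.cartesian_product ..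
  also have "(\<Sum>p\<in>?Z n \<times> ?Z k. ?f p) = (if n = 0 then 0 else y 0 * complete_sym y {0..<b + 2} (n - 1)) *
       (if k = 0 then 0 else x 0 * complete_sym x {0..<b + 2} (k - 1))"
    using sum_sorted_words_0_mem[of "b + 2" y n] sum_sorted_words_0_mem[of "b + 2" x k]
    unfolding sum.cartesian_product[symmetric] sum_product[symmetric] by simp
  also have "y 0 * x 0 = 1" using nz by (simp add: y_def)
  hence "(if n = 0 then 0 else y 0 * complete_sym y {0..<b + 2} (n - 1)) *
       (if k = 0 then 0 else x 0 * complete_sym x {0..<b + 2} (k - 1))
     = (if k = 0 \<or> n = 0 then 0 else complete_sym x {0..<b + 2} (k - 1) * complete_sym y {0..<b + 2} (n - 1))"
    by (simp add: algebra_simps)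
  finally show ?thesis by (simp add: atLeast0LessThan mult.commute)
qed

section \<open>Gaussian polynomials\<close>

definition eval_int :: "int poly \<Rightarrow> 'a::comm_ring_1 \<Rightarrow> 'a" where
  "eval_int p q = poly (map_poly of_int p) q"

lemma eval_int_pCons [simp]: "eval_int (pCons c p) q = of_int c + q * eval_int p q"
  by (simp add: eval_int_def map_poly_pCons)

lemma eval_int_0 [simp]: "eval_int 0 q = 0"
  by (simp add: eval_int_def)

lemma eval_int_1 [simp]: "eval_int 1 q = 1"
  by (simp add: one_pCons)

lemma eval_int_add [simp]: "eval_int (p + r) q = eval_int p q + eval_int r q"
  by (induction p r rule: poly_induct2) (simp_all add: algebra_simps)

lemma eval_int_smult [simp]: "eval_int (smult c p) q = of_int c * eval_int p q"
  by (induction p) (simp_all add: algebra_simps)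

lemma eval_int_mult [simp]: "eval_int (p * r) q = eval_int p q * eval_int r q"
  by (induction p) (simp_all add: algebra_simps)

lemma eval_int_monom [simp]: "eval_int (monom c n) q = of_int c * q ^ n"
  by (induction n) (simp_all add: monom_0 monom_Suc mult_ac)

text \<open>
  The Gaussian binomial coefficient \<open>[b + j, j]\<close>, by its Pascal recursion.
\<close>
fun gauss_poly :: "nat \<Rightarrow> nat \<Rightarrow> int poly" where
  "gauss_poly b 0 = 1"
| "gauss_poly 0 (Suc j) = 1"
| "gauss_poly (Suc b) (Suc j) = gauss_poly b (Suc j) + monom 1 (Suc b) * gauss_poly (Suc b) j"

lemma gauss_poly_0 [simp]: "gauss_poly 0 j = 1"
  by (cases j) simp_all

text \<open>
  The recursion of \<open>gauss_poly\<close> says that passing from \<open>b\<close> to \<open>b + 1\<close> divides the first factor by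
  \<open>1 - t^(b + 2) * z\<close>, the factor that the second one gains.
\<close>
lemma gauss_euler_product:
  fixes t :: "'a::field"
  shows "Abs_fps (\<lambda>j. t ^ j * eval_int (gauss_poly b j) t) * fps_of_poly (\<Prod>i<b + 2. [:1, - (t ^ i):]) = 1 - fps_X"
proof (induction b)
  case 0
  have geometric: "(1 - fps_const t * fps_X) * Abs_fps (\<lambda>j. t ^ j) = 1"
  proof (rule fps_ext)
    fix n show "((1 - fps_const t * fps_X) * Abs_fps (\<lambda>j. t ^ j)) $ n = (1 :: 'a fps) $ n"
      by (cases n) (simp_all add: left_diff_distrib mult.assoc)
  qed
  have prod: "(\<Prod>i<0 + 2. [:1, - (t ^ i):]) = [:1, - 1:] * [:1, - t:]"
    by (simp only: numeral_2_eq_2 add_0 prod.lessThan_Suc lessThan_0 prod.empty power_0 power_Suc0_right power_one mult_1 One_nat_def)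
  have lin: "fps_of_poly [:1, - c:] = 1 - fps_const c * fps_X" for c :: 'a
    by (simp add: fps_of_poly_pCons)
  have "Abs_fps (\<lambda>j. t ^ j) * fps_of_poly (\<Prod>i<0 + 2. [:1, - (t ^ i):])
      = (1 - fps_const 1 * fps_X) * ((1 - fps_const t * fps_X) * Abs_fps (\<lambda>j. t ^ j))"
    unfolding prod fps_of_poly_mult lin by (simp only: mult_ac)
  also have "\<dots> = 1 - fps_X"
    unfolding geometric by simp
  finally show ?case by (simp only: gauss_poly_0 eval_int_1 mult_1_right)
next
  case (Suc b)
  let ?F = "\<lambda>b. Abs_fps (\<lambda>j. t ^ j * eval_int (gauss_poly b j) t)"
  let ?E = "\<lambda>N. fps_of_poly (\<Prod>i<N. [:1, - (t ^ i):])"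
  have F: "(1 - fps_const (t ^ (b + 2)) * fps_X) * ?F (Suc b) = ?F b"
  proof (rule fps_ext)
    fix n show "((1 - fps_const (t ^ (b + 2)) * fps_X) * ?F (Suc b)) $ n = ?F b $ n"
      by (cases n) (simp_all add: algebra_simps)
  qed
  have E: "?E (Suc b + 2) = ?E (b + 2) * (1 - fps_const (t ^ (b + 2)) * fps_X)"
    by (simp add: fps_of_poly_mult fps_of_poly_pCons)
  have "?F (Suc b) * ?E (Suc b + 2) = ?F b * ?E (b + 2)"
    unfolding E F[symmetric] by (simp only: mult_ac)
  thus ?case using Suc by simp
qed

lemma gauss_euler_convolution:
  fixes t :: "'a::field"
  shows "(\<Sum>j\<le>l. t ^ j * eval_int (gauss_poly b j) t * euler_coeff t (b + 2) (l - j))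
    = (if l = 0 then 1 else if l = 1 then - 1 else 0)"
proof -
  have "(\<Sum>j\<le>l. t ^ j * eval_int (gauss_poly b j) t * euler_coeff t (b + 2) (l - j))
    = fps_nth (Abs_fps (\<lambda>j. t ^ j * eval_int (gauss_poly b j) t) * fps_of_poly (\<Prod>i<b + 2. [:1, - (t ^ i):])) l"
    by (simp only: fps_mult_nth fps_nth_Abs_fps fps_of_poly_nth euler_coeff_def atLeast0AtMost)
  thus ?thesis unfolding gauss_euler_product by (auto simp: fps_X_def)
qed

lemma qbracket_add:
  fixes q :: "'a::field"
  assumes "q \<noteq> 1" shows "qbracket q (m + n) = qbracket q m + q ^ m * qbracket q n"
  using assms by (simp add: qbracket_def power_add right_diff_distrib add_divide_distrib[symmetric])

lemma qfactorial_0 [simp]: "qfactorial q 0 = 1"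
  by (simp add: qfactorial_def)

lemma qfactorial_Suc [simp]: "qfactorial q (Suc n) = qfactorial q n * qbracket q (Suc n)"
  by (simp add: qfactorial_def)

lemma qfactorial_nonzero:
  fixes q :: "'a::field"
  assumes "\<And>i. i > 0 \<Longrightarrow> q ^ i \<noteq> 1" shows "qfactorial q n \<noteq> 0"
  using assms assms[of 1] by (auto simp: qfactorial_def qbracket_def)

lemma eval_gauss_poly:
  fixes q :: "'a::field"
  assumes q: "\<And>i. i > 0 \<Longrightarrow> q ^ i \<noteq> 1"
  shows "eval_int (gauss_poly b j) q = qfactorial q (b + j) / (qfactorial q j * qfactorial q b)"
proof -
  have nz: "qfactorial q n \<noteq> 0" for n using q by (rule qfactorial_nonzero)
  have bz: "qbracket q (Suc n) \<noteq> 0" for n using nz[of "Suc n"] by auto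
  show ?thesis
  proof (induction b j rule: gauss_poly.induct)
    case (3 b j)
    have *: "qbracket q (Suc (Suc (b + j))) = qbracket q (Suc b) + q ^ Suc b * qbracket q (Suc j)"
      using qbracket_add[of q "Suc b" "Suc j"] q[of 1] by simp
    have "eval_int (gauss_poly (Suc b) (Suc j)) q = qfactorial q (Suc (b + j)) / (qfactorial q (Suc j) * qfactorial q b)
       + q ^ Suc b * (qfactorial q (Suc (b + j)) / (qfactorial q j * qfactorial q (Suc b)))"
      using 3 by simp
    also have "\<dots> = qfactorial q (Suc (b + j)) * (qbracket q (Suc b) + q ^ Suc b * qbracket q (Suc j)) / (qfactorial q (Suc j) * qfactorial q (Suc b))"
      using nz[of j] nz[of b] bz[of j] bz[of b] by (simp add: divide_simps del: power_Suc) (simp add: algebra_simps)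
    finally show ?case unfolding *[symmetric] by simp
  qed (use nz bz in auto)
qed

lemma qbracket_inverse:
  fixes q :: "'a::field"
  assumes "q \<noteq> 0" "q \<noteq> 1" shows "q ^ n * qbracket (inverse q) (Suc n) = qbracket q (Suc n)"
proof -
  have "inverse q \<noteq> 1" using assms by auto
  thus ?thesis using assms unfolding qbracket_def by (simp add: divide_simps power_inverse) (simp add: algebra_simps)
qed

lemma qfactorial_inverse:
  fixes q :: "'a::field"
  assumes "q \<noteq> 0" "q \<noteq> 1" shows "q ^ (n choose 2) * qfactorial (inverse q) n = qfactorial q n"
proof (induction n)
  case (Suc n)
  have "q ^ (Suc n choose 2) * qfactorial (inverse q) (Suc n)
      = (q ^ (n choose 2) * qfactorial (inverse q) n) * (q ^ n * qbracket (inverse q) (Suc n))"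
    by (simp add: numeral_2_eq_2 power_add mult_ac)
  thus ?case using Suc qbracket_inverse[OF assms] by simp
qed (simp add: numeral_2_eq_2)

text \<open>
  The Gaussian polynomial is palindromic of degree \<open>b * j\<close>.
\<close>
lemma eval_gauss_poly_inverse:
  fixes q :: "'a::field"
  assumes "q \<noteq> 0" and q: "\<And>i. i > 0 \<Longrightarrow> q ^ i \<noteq> 1"
  shows "q ^ (b * j) * eval_int (gauss_poly b j) (inverse q) = eval_int (gauss_poly b j) q"
proof -
  have q': "inverse q ^ i \<noteq> 1" if "i > 0" for i using q[OF that] by (simp add: power_inverse)
  have q1: "q \<noteq> 1" using q[of 1] by auto
  have "qfactorial q (b + j) / (qfactorial q j * qfactorial q b) =
     q ^ (b * j) * (qfactorial (inverse q) (b + j) / (qfactorial (inverse q) j * qfactorial (inverse q) b))"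
    unfolding qfactorial_inverse[OF assms(1) q1, symmetric] choose_two_add power_add
    using assms(1) by (simp add: field_simps)
  thus ?thesis using eval_gauss_poly[OF q, of b j] eval_gauss_poly[OF q', of b j] by simp
qed

lemma qvar_nonzero: "qvar \<noteq> 0"
  by (simp add: qvar_def)

lemma qvar_power_neq_1:
  assumes "i > 0" shows "qvar ^ i \<noteq> 1"
proof
  assume "qvar ^ i = 1"
  have "to_fract ([:0, 1:] ^ i :: int poly) = qvar ^ i"
    by (induction i) (simp_all only: qvar_def power_Suc power_0 to_fract_mult to_fract_1)
  hence "to_fract ([:0, 1:] ^ i :: int poly) = to_fract 1" using \<open>qvar ^ i = 1\<close> by simp
  hence "([:0, 1:] ^ i :: int poly) = 1" by (simp only: to_fract_eq_iff)
  hence "degree ([:0, 1:] ^ i :: int poly) = 0" by simp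
  thus False using assms by (simp add: degree_power_eq)
qed

section \<open>Linear independence of Hall-Littlewood polynomials\<close>

definition compositions :: "nat \<Rightarrow> nat \<Rightarrow> nat list set" where
  "compositions N d = {\<alpha>. length \<alpha> = N \<and> sum_list \<alpha> = d}"

text \<open>
  The summand of \<open>hall_littlewood\<close> at the rearrangement \<open>\<alpha>\<close>.
\<close>
definition hl_term :: "real \<Rightarrow> (nat \<Rightarrow> real) \<Rightarrow> nat list \<Rightarrow> real" where
  "hl_term t x \<alpha> = (\<Prod>i<length \<alpha>. x i ^ (\<alpha> ! i)) *
     (\<Prod>(i, j)\<in>{(i, j). i < length \<alpha> \<and> j < length \<alpha> \<and> \<alpha> ! i > \<alpha> ! j}. (x i - t * x j) / (x i - x j))"

lemma composition_entry_le: "\<alpha> \<in> compositions N d \<Longrightarrow> i < N \<Longrightarrow> \<alpha> ! i \<le> d"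
  using elem_le_sum_list[of i \<alpha>] by (auto simp: compositions_def)

lemma finite_compositions: "finite (compositions N d)"
proof (rule finite_subset)
  show "compositions N d \<subseteq> {\<alpha>. set \<alpha> \<subseteq> {..d} \<and> length \<alpha> = N}"
    using composition_entry_le by (fastforce simp: in_set_conv_nth compositions_def)
qed (rule finite_lists_length_eq, simp)

lemma finite_partitions_of: "finite (partitions_of N d)"
  by (rule finite_subset[OF _ finite_compositions[of N d]]) (auto simp: partitions_of_def compositions_def)

text \<open>
  Every composition is a rearrangement of exactly one partition.
\<close>
lemma sum_partitions_hall_littlewood:
  "(\<Sum>\<nu>\<in>partitions_of N d. c \<nu> * hall_littlewood \<nu> x t) = (\<Sum>\<alpha>\<in>compositions N d. c (rev (sort \<alpha>)) * hl_term t x \<alpha>)"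
proof -
  have "(\<Sum>\<nu>\<in>partitions_of N d. c \<nu> * hall_littlewood \<nu> x t)
      = (\<Sum>\<nu>\<in>partitions_of N d. \<Sum>\<alpha>\<in>permutations_of_multiset (mset \<nu>). c \<nu> * hl_term t x \<alpha>)"
    unfolding hall_littlewood_def sum_distrib_left
  proof (intro sum.cong refl)
    fix \<nu> \<alpha> :: "nat list" assume "\<alpha> \<in> permutations_of_multiset (mset \<nu>)"
    hence "length \<nu> = length \<alpha>" by (metis permutations_of_multisetD size_mset)
    thus "c \<nu> * ((\<Prod>i<length \<nu>. x i ^ (\<alpha> ! i)) * (\<Prod>(i, j)\<in>{(i, j). i < length \<nu> \<and> j < length \<nu> \<and> \<alpha> ! j < \<alpha> ! i}. (x i - t * x j) / (x i - x j)))
       = c \<nu> * hl_term t x \<alpha>"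
      by (simp only: hl_term_def)
  qed
  also have "\<dots> = (\<Sum>(\<nu>, \<alpha>)\<in>Sigma (partitions_of N d) (\<lambda>\<nu>. permutations_of_multiset (mset \<nu>)). c \<nu> * hl_term t x \<alpha>)"
    by (rule sum.Sigma) (simp_all add: finite_partitions_of)
  also have "\<dots> = (\<Sum>\<alpha>\<in>compositions N d. c (rev (sort \<alpha>)) * hl_term t x \<alpha>)"
  proof (rule sum.reindex_bij_witness[where i = "\<lambda>\<alpha>. (rev (sort \<alpha>), \<alpha>)" and j = snd])
    fix p assume "p \<in> Sigma (partitions_of N d) (\<lambda>\<nu>. permutations_of_multiset (mset \<nu>))"
    then obtain \<nu> \<alpha> where p: "p = (\<nu>, \<alpha>)" "\<nu> \<in> partitions_of N d" "mset \<alpha> = mset \<nu>"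
      by (auto dest: permutations_of_multisetD)
    have "sorted (rev \<nu>)" using p(2) by (simp add: partitions_of_def sorted_wrt_rev)
    hence e: "rev (sort \<alpha>) = \<nu>" using p(3) properties_for_sort[of "rev \<nu>" \<alpha>] by simp
    thus "(rev (sort (snd p)), snd p) = p" by (simp add: p)
    show "c (rev (sort (snd p))) * hl_term t x (snd p) = (case p of (\<nu>, \<alpha>) \<Rightarrow> c \<nu> * hl_term t x \<alpha>)"
      by (simp add: p e)
    have "length \<alpha> = length \<nu>" "sum_list \<alpha> = sum_list \<nu>"
      using p(3) by (metis size_mset, metis sum_mset_sum_list)
    thus "snd p \<in> compositions N d" using p(2) by (simp add: p(1) compositions_def partitions_of_def)
  next
    fix \<alpha> assume \<alpha>: "\<alpha> \<in> compositions N d"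
    have "sum_list (sort \<alpha>) = sum_list \<alpha>" by (metis mset_sort sum_mset_sum_list)
    hence "rev (sort \<alpha>) \<in> partitions_of N d"
      using \<alpha> by (simp add: partitions_of_def compositions_def sorted_wrt_rev)
    thus "(rev (sort \<alpha>), \<alpha>) \<in> Sigma (partitions_of N d) (\<lambda>\<nu>. permutations_of_multiset (mset \<nu>))"
      by (auto intro: permutations_of_multisetI)
  qed simp
  finally show ?thesis .
qed

definition digit_value :: "nat \<Rightarrow> nat list \<Rightarrow> nat" where
  "digit_value B \<alpha> = (\<Sum>i<length \<alpha>. \<alpha> ! i * B ^ i)"

lemma digit_value_Cons: "digit_value B (a # \<alpha>) = a + B * digit_value B \<alpha>"
  by (simp add: digit_value_def sum.lessThan_Suc_shift sum_distrib_left mult_ac del: sum.lessThan_Suc)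

lemma digit_value_inject:
  assumes "length \<alpha> = length \<alpha>'" "set \<alpha> \<subseteq> {..<B}" "set \<alpha>' \<subseteq> {..<B}" "digit_value B \<alpha> = digit_value B \<alpha>'"
  shows "\<alpha> = \<alpha>'"
  using assms
proof (induction \<alpha> \<alpha>' rule: list_induct2)
  case (Cons a \<alpha> a' \<alpha>')
  have eq: "a + B * digit_value B \<alpha> = a' + B * digit_value B \<alpha>'" using Cons.prems(3) by (simp add: digit_value_Cons)
  have lt: "a < B" "a' < B" using Cons.prems by auto
  have "a = a'" using arg_cong[OF eq, of "\<lambda>n. n mod B"] lt by simp
  moreover from this have "digit_value B \<alpha> = digit_value B \<alpha>'" using eq lt by simp
  ultimately show ?case using Cons by auto
qed simp

lemma tendsto_power_ratio:
  fixes t :: real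
  assumes "p \<noteq> q"
  shows "((\<lambda>s. (s ^ p - t * s ^ q) / (s ^ p - s ^ q)) \<longlongrightarrow> (if p < q then 1 else t)) (at_right 0)"
proof -
  have pos: "eventually (\<lambda>s::real. s > 0) (at_right 0)" by (simp add: eventually_at_right_less)
  have lim0: "((\<lambda>s::real. s ^ Suc n) \<longlongrightarrow> 0) (at_right 0)" for n
    by (rule tendsto_eq_intros refl tendsto_ident_at | simp)+
  show ?thesis
  proof (cases "p < q")
    case True
    then obtain n where q: "q = p + Suc n" using less_iff_Suc_add by auto
    have "((\<lambda>s::real. (1 - t * s ^ Suc n) / (1 - s ^ Suc n)) \<longlongrightarrow> (1 - t * 0) / (1 - 0)) (at_right 0)"
      by (intro tendsto_intros lim0) simp
    moreover have "eventually (\<lambda>s::real. (1 - t * s ^ Suc n) / (1 - s ^ Suc n) = (s ^ p - t * s ^ q) / (s ^ p - s ^ q)) (at_right 0)"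
      using pos
    proof eventually_elim
      case (elim s)
      have "s ^ p - t * s ^ q = s ^ p * (1 - t * s ^ Suc n)" "s ^ p - s ^ q = s ^ p * (1 - s ^ Suc n)"
        by (simp_all add: q power_add algebra_simps)
      thus ?case using elim by simp
    qed
    ultimately show ?thesis using True by (auto intro: Lim_transform_eventually)
  next
    case False
    then obtain n where p: "p = q + Suc n" using assms less_iff_Suc_add[of q p] by auto
    have "((\<lambda>s::real. (s ^ Suc n - t) / (s ^ Suc n - 1)) \<longlongrightarrow> (0 - t) / (0 - 1)) (at_right 0)"
      by (intro tendsto_intros lim0) simp
    moreover have "eventually (\<lambda>s::real. (s ^ Suc n - t) / (s ^ Suc n - 1) = (s ^ p - t * s ^ q) / (s ^ p - s ^ q)) (at_right 0)"
      using pos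
    proof eventually_elim
      case (elim s)
      have "s ^ p - t * s ^ q = s ^ q * (s ^ Suc n - t)" "s ^ p - s ^ q = s ^ q * (s ^ Suc n - 1)"
        by (simp_all add: p power_add algebra_simps)
      thus ?case using elim by simp
    qed
    ultimately show ?thesis using False by (auto intro: Lim_transform_eventually)
  qed
qed

text \<open>
  Substitute \<open>x i = s^(B^i)\<close> with \<open>B > d\<close>. The monomial of \<open>\<alpha>\<close> becomes \<open>s\<close> to the number with base-\<open>B\<close>
  digits \<open>\<alpha>\<close>, so different compositions have different exponents. The order factors tend to \<open>1\<close> or \<open>t\<close> as
  \<open>s\<close> tends to \<open>0\<close>, hence the term with the least exponent dominates and its coefficient
  has to vanish. For \<open>t = 0\<close> that coefficient may come with the factor \<open>0\<close>; nonzero \<open>t\<close> suffice to compare polynomials in \<open>t\<close>.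
\<close>
lemma hl_terms_independent:
  fixes C :: "nat list \<Rightarrow> real"
  assumes zero: "\<And>x. inj_on x {..<N} \<Longrightarrow> (\<Sum>\<alpha>\<in>compositions N d. C \<alpha> * hl_term t x \<alpha>) = 0"
    and "t \<noteq> 0" and mem: "\<alpha> \<in> compositions N d"
  shows "C \<alpha> = 0"
proof (rule ccontr)
  assume "C \<alpha> \<noteq> 0"
  define A where "A = {\<alpha> \<in> compositions N d. C \<alpha> \<noteq> 0}"
  \<comment> \<open>Large enough for all entries to be digits, and at least \<open>2\<close> so that the powers of \<open>B\<close> are distinct even if \<open>d = 0\<close>.\<close>
  define B where "B = d + 2"
  define v where "v = digit_value B"
  have A: "finite A" "A \<noteq> {}" using finite_compositions mem \<open>C \<alpha> \<noteq> 0\<close> by (auto simp: A_def)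
  obtain \<alpha>0 where \<alpha>0: "\<alpha>0 \<in> A" and min: "\<And>\<alpha>. \<alpha> \<in> A \<Longrightarrow> v \<alpha>0 \<le> v \<alpha>"
    using ex_min_if_finite[of "v ` A"] A by (auto simp: not_less)
  have inj: "\<alpha> = \<alpha>'" if "\<alpha> \<in> A" "\<alpha>' \<in> A" "v \<alpha> = v \<alpha>'" for \<alpha> \<alpha>'
  proof (rule digit_value_inject[of _ _ B])
    have "set \<alpha> \<subseteq> {..<B}" if "\<alpha> \<in> A" for \<alpha>
      using composition_entry_le[of \<alpha> N d] that
      by (fastforce simp: A_def B_def in_set_conv_nth compositions_def)
    thus "set \<alpha> \<subseteq> {..<B}" "set \<alpha>' \<subseteq> {..<B}" using that by auto
  qed (use that in \<open>auto simp: A_def compositions_def v_def\<close>)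
  define x where "x s i = (s::real) ^ (B ^ i)" for s i
  define P where "P \<alpha> = {(i, j). i < length \<alpha> \<and> j < length \<alpha> \<and> \<alpha> ! i > (\<alpha> ! j :: nat)}" for \<alpha>
  define R where "R s \<alpha> = (\<Prod>(i, j)\<in>P \<alpha>. (x s i - t * x s j) / (x s i - x s j))" for s \<alpha>
  define L where "L \<alpha> = (\<Prod>(i, j)\<in>P \<alpha>. if B ^ i < B ^ j then 1 else t)" for \<alpha>
  have B_inj: "B ^ i \<noteq> B ^ j" if "i \<noteq> j" for i j
    using that by (simp add: B_def)
  have hl_eq: "hl_term t (x s) \<alpha> = s ^ v \<alpha> * R s \<alpha>" for s \<alpha>
    by (simp add: hl_term_def R_def P_def x_def v_def digit_value_def power_sum mult.commute flip: power_mult)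
  have finP: "finite (P \<alpha>)" for \<alpha>
    by (rule finite_subset[of _ "{..<length \<alpha>} \<times> {..<length \<alpha>}"]) (auto simp: P_def)
  have lim_R: "((\<lambda>s. R s \<alpha>) \<longlongrightarrow> L \<alpha>) (at_right 0)" for \<alpha>
    unfolding R_def L_def
  proof (rule tendsto_prod)
    fix p assume p: "p \<in> P \<alpha>"
    obtain i j where ij: "p = (i, j)" by force
    have "i \<noteq> j" using p by (auto simp: P_def ij)
    thus "((\<lambda>s. case p of (i, j) \<Rightarrow> (x s i - t * x s j) / (x s i - x s j)) \<longlongrightarrow> (case p of (i, j) \<Rightarrow> if B ^ i < B ^ j then 1 else t)) (at_right 0)"
      unfolding ij prod.case x_def by (intro tendsto_power_ratio B_inj)
  qed
  let ?S = "\<lambda>s. \<Sum>\<alpha>\<in>A. C \<alpha> * (s ^ (v \<alpha> - v \<alpha>0) * R s \<alpha>)"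
  have "((\<lambda>s::real. s ^ (v \<alpha> - v \<alpha>0)) \<longlongrightarrow> (if \<alpha> = \<alpha>0 then 1 else 0)) (at_right 0)" if "\<alpha> \<in> A" for \<alpha>
  proof (cases "\<alpha> = \<alpha>0")
    case False
    hence "v \<alpha> - v \<alpha>0 > 0" using min[OF that] inj[OF that \<alpha>0] by fastforce
    hence "((\<lambda>s::real. s ^ (v \<alpha> - v \<alpha>0)) \<longlongrightarrow> 0 ^ (v \<alpha> - v \<alpha>0)) (at_right 0)"
      by (intro tendsto_power tendsto_ident_at)
    thus ?thesis using False \<open>v \<alpha> - v \<alpha>0 > 0\<close> by (simp add: zero_power)
  qed simp
  hence "(?S \<longlongrightarrow> (\<Sum>\<alpha>\<in>A. C \<alpha> * ((if \<alpha> = \<alpha>0 then 1 else 0) * L \<alpha>))) (at_right 0)"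
    by (intro tendsto_sum tendsto_mult tendsto_const lim_R) auto
  moreover have "(\<Sum>\<alpha>\<in>A. C \<alpha> * ((if \<alpha> = \<alpha>0 then 1 else 0) * L \<alpha>)) = C \<alpha>0 * L \<alpha>0"
  proof -
    have "(\<Sum>\<alpha>\<in>A. C \<alpha> * ((if \<alpha> = \<alpha>0 then 1 else 0) * L \<alpha>)) = (\<Sum>\<alpha>\<in>A. if \<alpha> = \<alpha>0 then C \<alpha>0 * L \<alpha>0 else 0)"
      by (intro sum.cong) auto
    thus ?thesis using A \<alpha>0 by simp
  qed
  ultimately have lim1: "(?S \<longlongrightarrow> C \<alpha>0 * L \<alpha>0) (at_right 0)" by simp
  have "eventually (\<lambda>s. s \<in> {0<..<1::real}) (at_right 0)"
    by (intro eventually_at_right_real) simp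
  hence "eventually (\<lambda>s. 0 = ?S s) (at_right 0)"
  proof eventually_elim
    case (elim s)
    have "inj_on (x s) {..<N}"
    proof (rule inj_onI)
      fix i j assume "x s i = x s j"
      thus "i = j" using elim B_inj[of i j] power_inject_exp'[of s] unfolding x_def
        by (metis greaterThanLessThan_iff less_irrefl)
    qed
    hence "0 = (\<Sum>\<alpha>\<in>compositions N d. C \<alpha> * hl_term t (x s) \<alpha>)" by (simp add: zero)
    also have "\<dots> = (\<Sum>\<alpha>\<in>A. C \<alpha> * hl_term t (x s) \<alpha>)"
      by (intro sum.mono_neutral_right finite_compositions) (auto simp: A_def)
    also have "\<dots> = (\<Sum>\<alpha>\<in>A. s ^ v \<alpha>0 * (C \<alpha> * (s ^ (v \<alpha> - v \<alpha>0) * R s \<alpha>)))"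
    proof (intro sum.cong refl)
      fix \<alpha> assume "\<alpha> \<in> A"
      have "s ^ v \<alpha> = s ^ v \<alpha>0 * s ^ (v \<alpha> - v \<alpha>0)"
        unfolding power_add[symmetric] using min[OF \<open>\<alpha> \<in> A\<close>] by simp
      thus "C \<alpha> * hl_term t (x s) \<alpha> = s ^ v \<alpha>0 * (C \<alpha> * (s ^ (v \<alpha> - v \<alpha>0) * R s \<alpha>))"
        by (simp add: hl_eq)
    qed
    also have "\<dots> = s ^ v \<alpha>0 * ?S s" by (rule sum_distrib_left[symmetric])
    finally show ?case using elim by simp
  qed
  hence "(?S \<longlongrightarrow> 0) (at_right 0)"
    by (rule Lim_transform_eventually[OF tendsto_const])
  hence "C \<alpha>0 * L \<alpha>0 = 0" using lim1 tendsto_unique trivial_limit_at_right_real by blast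
  moreover have "L \<alpha>0 \<noteq> 0" using finP \<open>t \<noteq> 0\<close> by (auto simp: L_def split_beta)
  ultimately show False using \<alpha>0 by (simp add: A_def)
qed

section \<open>The expansion in Hall-Littlewood polynomials\<close>

text \<open>
  The size of the negative part of \<open>\<nu> - n\<close>. The number \<open>\<beta>\<close> of a tuple equals \<open>n\<close> minus its deficit (\<open>beta_eq\<close>).
\<close>
definition deficit :: "nat \<Rightarrow> nat list \<Rightarrow> nat" where
  "deficit n \<nu> = (\<Sum>i<length \<nu>. n - \<nu> ! i)"

definition overlap_exponent :: "nat \<Rightarrow> nat list \<Rightarrow> nat" where
  "overlap_exponent n \<nu> = (\<Sum>i<length \<nu>. \<Sum>j<length \<nu>. if i < j then min (\<nu> ! i - n) (\<nu> ! j - n) + min (n - \<nu> ! i) (n - \<nu> ! j) else 0)"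

text \<open>
  The coefficient of the Hall-Littlewood polynomial of \<open>\<nu>\<close> in the Schur polynomial of
  \<open>(n + k) # replicate b n\<close>; it depends on \<open>k\<close> only through the size of \<open>\<nu>\<close>.
\<close>
definition kf_poly :: "nat \<Rightarrow> nat \<Rightarrow> nat list \<Rightarrow> int poly" where
  "kf_poly b n \<nu> = (if deficit n \<nu> \<le> n
     then monom 1 (overlap_exponent n \<nu> + (n - deficit n \<nu>)) * gauss_poly b (n - deficit n \<nu>) else 0)"

lemma sum_list_map_mset_cong: "mset \<alpha> = mset \<beta> \<Longrightarrow> sum_list (map f \<alpha>) = (sum_list (map f \<beta>) :: 'a::comm_monoid_add)"
  by (metis mset_map sum_mset_sum_list)

lemma sum_list_map_conv_sum: "sum_list (map f \<alpha>) = (\<Sum>i<length \<alpha>. f (\<alpha> ! i))"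
  by (simp add: sum_list_sum_nth atLeast0LessThan)

text \<open>
  The sum over all ordered pairs is visibly invariant; it is twice the sum over \<open>i < j\<close> plus the diagonal.
\<close>
lemma sum_pairs_mset_cong:
  fixes f :: "'a \<Rightarrow> 'a \<Rightarrow> nat"
  assumes sym: "\<And>u v. f u v = f v u" and eq: "mset \<alpha> = mset \<beta>"
  shows "(\<Sum>i<length \<alpha>. \<Sum>j<length \<alpha>. if i < j then f (\<alpha> ! i) (\<alpha> ! j) else 0)
    = (\<Sum>i<length \<beta>. \<Sum>j<length \<beta>. if i < j then f (\<beta> ! i) (\<beta> ! j) else 0)"
proof -
  let ?p = "\<lambda>\<alpha>. \<Sum>i<length \<alpha>. \<Sum>j<length \<alpha>. if i < j then f (\<alpha> ! i) (\<alpha> ! j) else 0"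
  have double: "2 * ?p \<alpha> + sum_list (map (\<lambda>u. f u u) \<alpha>) = sum_list (map (\<lambda>u. sum_list (map (f u) \<alpha>)) \<alpha>)" for \<alpha>
  proof -
    let ?L = "length \<alpha>"
    have "sum_list (map (\<lambda>u. sum_list (map (f u) \<alpha>)) \<alpha>)
        = (\<Sum>i<?L. \<Sum>j<?L. (if i < j then f (\<alpha> ! i) (\<alpha> ! j) else 0)
             + ((if j < i then f (\<alpha> ! i) (\<alpha> ! j) else 0) + (if j = i then f (\<alpha> ! i) (\<alpha> ! j) else 0)))"
      unfolding sum_list_map_conv_sum by (intro sum.cong refl) auto
    also have "\<dots> = ?p \<alpha> + ((\<Sum>i<?L. \<Sum>j<?L. if j < i then f (\<alpha> ! i) (\<alpha> ! j) else 0) + (\<Sum>i<?L. f (\<alpha> ! i) (\<alpha> ! i)))"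
      unfolding sum.distrib by simp
    also have "(\<Sum>i<?L. \<Sum>j<?L. if j < i then f (\<alpha> ! i) (\<alpha> ! j) else 0) = ?p \<alpha>"
      by (subst sum.swap) (simp only: sym)
    finally show ?thesis unfolding sum_list_map_conv_sum by simp
  qed
  have "sum_list (map (\<lambda>u. sum_list (map (f u) \<alpha>)) \<alpha>) = sum_list (map (\<lambda>u. sum_list (map (f u) \<beta>)) \<beta>)"
    unfolding sum_list_map_mset_cong[OF eq, of "f _"] by (rule sum_list_map_mset_cong[OF eq])
  thus ?thesis using double[of \<alpha>] double[of \<beta>] sum_list_map_mset_cong[OF eq, of "\<lambda>u. f u u"] by simp
qed

lemma overlap_exponent_mset_cong: "mset \<alpha> = mset \<beta> \<Longrightarrow> overlap_exponent n \<alpha> = overlap_exponent n \<beta>"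
  unfolding overlap_exponent_def
  by (rule sum_pairs_mset_cong[of "\<lambda>u v. min (u - n) (v - n) + min (n - u) (n - v)"]) (simp_all add: min.commute)

lemma deficit_mset_cong: "mset \<alpha> = mset \<beta> \<Longrightarrow> deficit n \<alpha> = deficit n \<beta>"
  using sum_list_map_mset_cong[of \<alpha> \<beta> "\<lambda>u. n - u"] by (simp add: deficit_def sum_list_map_conv_sum)

definition centered :: "nat \<Rightarrow> nat list \<Rightarrow> nat \<Rightarrow> int" where
  "centered n \<alpha> i = (if i < length \<alpha> then int (\<alpha> ! i) - int n else 0)"

lemma signed_weight_centered:
  assumes "length \<alpha> = N" and nz: "\<forall>i<N. x i \<noteq> 0"
  shows "t ^ overlap_exponent n \<alpha> * hl_term t x \<alpha> = (\<Prod>i<N. x i) ^ n * signed_weight t x {..<N} (centered n \<alpha>)"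
proof -
  let ?a = "centered n \<alpha>"
  let ?P = "{(i, j). i < N \<and> j < N \<and> \<alpha> ! i > \<alpha> ! j}"
  have monomial: "(\<Prod>i<N. x i) ^ n * (\<Prod>i<N. x i powi ?a i) = (\<Prod>i<N. x i ^ (\<alpha> ! i))"
    unfolding prod_power_distrib prod.distrib[symmetric]
  proof (intro prod.cong refl)
    fix i assume "i \<in> {..<N}"
    thus "x i ^ n * x i powi ?a i = x i ^ (\<alpha> ! i)"
      using assms by (simp add: centered_def power_int_diff)
  qed
  have order: "(\<Prod>i<N. \<Prod>j<N. order_factor t x ?a i j) = (\<Prod>(i, j)\<in>?P. (x i - t * x j) / (x i - x j))"
  proof -
    have "(\<Prod>i<N. \<Prod>j<N. order_factor t x ?a i j) = (\<Prod>(i, j)\<in>{..<N} \<times> {..<N}. order_factor t x ?a i j)"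
      by (rule prod.cartesian_product)
    also have "\<dots> = (\<Prod>(i, j)\<in>?P. (x i - t * x j) / (x i - x j))"
      using assms(1) by (intro prod.mono_neutral_cong_right) (auto simp: order_factor_def centered_def split: if_splits)
    finally show ?thesis .
  qed
  have overlap: "(\<Prod>i<N. \<Prod>j<N. overlap_factor t ?a i j) = t ^ overlap_exponent n \<alpha>"
    unfolding overlap_exponent_def power_sum assms(1)
  proof (intro prod.cong refl)
    fix i j assume "i \<in> {..<N}" "j \<in> {..<N}"
    moreover have "nat (min (int u - int n) (int v - int n)) = min (u - n) (v - n)"
      "nat (min (- (int u - int n)) (- (int v - int n))) = min (n - u) (n - v)" for u v
      by linarith+
    ultimately show "overlap_factor t ?a i j =
        t ^ (if i < j then min (\<alpha> ! i - n) (\<alpha> ! j - n) + min (n - \<alpha> ! i) (n - \<alpha> ! j) else 0)"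
      using assms(1) by (simp only: overlap_factor_def centered_def lessThan_iff if_True split: if_split) simp
  qed
  show ?thesis
    unfolding signed_weight_def hl_term_def prod.distrib assms(1) monomial[symmetric] order overlap
    by (simp only: mult_ac)
qed

text \<open>
  The positive and negative parts of a centered composition differ by \<open>k - n\<close> in size, so a negative part of size
  \<open>n - \<beta>\<close> forces a positive part of size \<open>k - \<beta>\<close>. Conversely, entries of a vector with negative part
  at most \<open>n\<close> stay nonnegative after adding \<open>n\<close>.
\<close>
lemma sum_compositions_centered:
  fixes F :: "(nat \<Rightarrow> int) \<Rightarrow> 'a::comm_monoid_add"
  assumes d: "d + n = k + n * N" and \<beta>: "\<beta> \<le> min k n"
  shows "(\<Sum>\<alpha> | \<alpha> \<in> compositions N d \<and> deficit n \<alpha> \<le> n \<and> n - deficit n \<alpha> = \<beta>. F (centered n \<alpha>))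
    = (\<Sum>a\<in>signed_vectors {..<N} (k - \<beta>) (n - \<beta>). F a)"
proof (rule sum.reindex_bij_witness[where j = "centered n" and i = "\<lambda>a. map (\<lambda>i. nat (a i + int n)) [0..<N]"])
  have balance: "int (\<Sum>i\<in>{..<N}. nat (a i)) - int (\<Sum>i\<in>{..<N}. nat (- a i)) = (\<Sum>i<N. a i)" for a :: "nat \<Rightarrow> int"
    unfolding of_nat_sum sum_subtractf[symmetric] by (intro sum.cong) auto
  {
    fix \<alpha> assume \<alpha>: "\<alpha> \<in> {\<alpha>. \<alpha> \<in> compositions N d \<and> deficit n \<alpha> \<le> n \<and> n - deficit n \<alpha> = \<beta>}"
    hence len: "length \<alpha> = N" and sum: "sum_list \<alpha> = d" and def: "deficit n \<alpha> = n - \<beta>"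
      using \<beta> by (auto simp: compositions_def)
    show "map (\<lambda>i. nat (centered n \<alpha> i + int n)) [0..<N] = \<alpha>"
      using len by (intro nth_equalityI) (auto simp: centered_def)
    have "(\<Sum>i<N. centered n \<alpha> i) = (\<Sum>i<N. int (\<alpha> ! i) - int n)"
      using len by (intro sum.cong) (auto simp: centered_def)
    also have "\<dots> = int d - int n * int N"
      using sum_list_map_conv_sum[of "\<lambda>u. u" \<alpha>] len sum by (simp add: sum_subtractf flip: of_nat_sum)
    finally have s: "(\<Sum>i<N. centered n \<alpha> i) = int k - int n" using d by (simp flip: of_nat_mult)
    have r: "(\<Sum>i<N. nat (- centered n \<alpha> i)) = n - \<beta>"
      unfolding def[symmetric] deficit_def len by (intro sum.cong) (auto simp: centered_def len)
    hence "(\<Sum>i<N. nat (centered n \<alpha> i)) = k - \<beta>"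
      using balance[of "centered n \<alpha>"] s \<beta> by linarith
    thus "centered n \<alpha> \<in> signed_vectors {..<N} (k - \<beta>) (n - \<beta>)"
      using r len by (simp add: signed_vectors_def centered_def)
  }
  fix a assume a: "a \<in> signed_vectors {..<N} (k - \<beta>) (n - \<beta>)"
  let ?\<alpha> = "map (\<lambda>i. nat (a i + int n)) [0..<N]"
  have zero: "a i = 0" if "\<not> i < N" for i using a that by (auto simp: signed_vectors_def)
  have p: "(\<Sum>i<N. nat (a i)) = k - \<beta>" and r: "(\<Sum>i<N. nat (- a i)) = n - \<beta>"
    using a by (auto simp: signed_vectors_def)
  have ge: "a i + int n \<ge> 0" for i
  proof (cases "i < N")
    case True
    hence "nat (- a i) \<le> (\<Sum>i<N. nat (- a i))" by (intro member_le_sum) auto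
    thus ?thesis using r by linarith
  qed (use zero in auto)
  show c: "centered n ?\<alpha> = a"
    using ge zero by (auto simp: centered_def fun_eq_iff)
  have "int (sum_list ?\<alpha>) = (\<Sum>i<N. a i + int n)"
    using ge by (simp add: interv_sum_list_conv_sum_set_nat atLeast0LessThan)
  also have "\<dots> = int k - int n + int n * int N"
    using balance[of a] p r \<beta> by (simp add: sum.distrib)
  also have "\<dots> = int d" using d by (simp flip: of_nat_mult)
  finally have "sum_list ?\<alpha> = d" by linarith
  moreover have "deficit n ?\<alpha> = n - \<beta>"
    unfolding r[symmetric] deficit_def
  proof (intro sum.cong)
    fix i assume "i \<in> {..<N}"
    thus "n - ?\<alpha> ! i = nat (- a i)" using ge[of i] by simp
  qed simp
  ultimately show "?\<alpha> \<in> {\<alpha>. \<alpha> \<in> compositions N d \<and> deficit n \<alpha> \<le> n \<and> n - deficit n \<alpha> = \<beta>}"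
    using \<beta> by (simp add: compositions_def)
qed simp

lemma deficit_ge:
  assumes d: "d + n = k + n * N" and \<alpha>: "\<alpha> \<in> compositions N d" "deficit n \<alpha> \<le> n"
  shows "n - deficit n \<alpha> \<le> min k n"
proof -
  have "n * N \<le> (\<Sum>i<N. \<alpha> ! i + (n - \<alpha> ! i))"
    using sum_mono[of "{..<N}" "\<lambda>_. n" "\<lambda>i. \<alpha> ! i + (n - \<alpha> ! i)"] by (simp add: mult.commute)
  also have "\<dots> = d + deficit n \<alpha>"
    using \<alpha>(1) sum_list_map_conv_sum[of "\<lambda>u. u" \<alpha>] by (simp add: compositions_def sum.distrib deficit_def)
  finally show ?thesis using d by linarith
qed

text \<open>
  Grouping compositions by \<open>\<beta>\<close> gives a sum of \<open>signed_sum\<close>s. After \<open>signed_sum_eq\<close>, the coefficient of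
  \<open>h (k - l) x * h (n - l) y\<close> is the convolution in \<open>gauss_euler_convolution\<close>, which leaves \<open>l = 0\<close> and \<open>l = 1\<close>.
\<close>
lemma hall_littlewood_expansion_complete_sym:
  fixes x :: "nat \<Rightarrow> real"
  assumes d: "d + n = k + n * (b + 2)" and inj: "inj_on x {..<b + 2}" and nz: "\<forall>i<b + 2. x i \<noteq> 0"
  defines "y \<equiv> \<lambda>i. inverse (x i)"
  shows "(\<Sum>\<nu>\<in>partitions_of (b + 2) d. eval_int (kf_poly b n \<nu>) t * hall_littlewood \<nu> x t) =
    (\<Prod>i<b + 2. x i) ^ n * (complete_sym x {..<b + 2} k * complete_sym y {..<b + 2} n
      - (if k = 0 \<or> n = 0 then 0 else complete_sym x {..<b + 2} (k - 1) * complete_sym y {..<b + 2} (n - 1)))"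
proof -
  let ?N = "b + 2"
  let ?S = "{..<b + 2}"
  let ?P = "(\<Prod>i<b + 2. x i) ^ n"
  let ?A = "{\<alpha> \<in> compositions ?N d. deficit n \<alpha> \<le> n}"
  define g where "g \<beta> = t ^ \<beta> * eval_int (gauss_poly b \<beta>) t" for \<beta>
  define h where "h l = complete_sym x ?S (k - l) * complete_sym y ?S (n - l)" for l
  let ?e = "euler_coeff t ?N"
  have "(\<Sum>\<nu>\<in>partitions_of ?N d. eval_int (kf_poly b n \<nu>) t * hall_littlewood \<nu> x t)
      = (\<Sum>\<alpha>\<in>compositions ?N d. eval_int (kf_poly b n (rev (sort \<alpha>))) t * hl_term t x \<alpha>)"
    by (rule sum_partitions_hall_littlewood)
  also have "\<dots> = (\<Sum>\<alpha>\<in>?A. g (n - deficit n \<alpha>) * (?P * signed_weight t x ?S (centered n \<alpha>)))"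
  proof (intro sum.mono_neutral_cong_right finite_compositions ballI)
    fix \<alpha> assume \<alpha>: "\<alpha> \<in> ?A"
    hence len: "length \<alpha> = ?N" by (simp add: compositions_def)
    have s: "overlap_exponent n (rev (sort \<alpha>)) = overlap_exponent n \<alpha>" "deficit n (rev (sort \<alpha>)) = deficit n \<alpha>"
      by (intro overlap_exponent_mset_cong deficit_mset_cong; simp)+
    have "eval_int (kf_poly b n (rev (sort \<alpha>))) t * hl_term t x \<alpha>
        = g (n - deficit n \<alpha>) * (t ^ overlap_exponent n \<alpha> * hl_term t x \<alpha>)"
      using \<alpha> by (simp add: kf_poly_def s g_def power_add mult_ac del: Nat.add_diff_assoc Nat.add_diff_assoc2)
    thus "eval_int (kf_poly b n (rev (sort \<alpha>))) t * hl_term t x \<alpha> = g (n - deficit n \<alpha>) * (?P * signed_weight t x ?S (centered n \<alpha>))"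
      by (simp only: signed_weight_centered[OF len nz])
  qed (auto simp: kf_poly_def deficit_mset_cong[of "rev (sort _)"])
  also have "\<dots> = (\<Sum>\<beta>\<le>min k n. \<Sum>\<alpha> | \<alpha> \<in> ?A \<and> n - deficit n \<alpha> = \<beta>.
      g (n - deficit n \<alpha>) * (?P * signed_weight t x ?S (centered n \<alpha>)))"
    using deficit_ge[OF d] finite_compositions[of ?N d] by (intro sum.group[symmetric]) auto
  also have "\<dots> = (\<Sum>\<beta>\<le>min k n. ?P * (g \<beta> * signed_sum t x ?S (k - \<beta>) (n - \<beta>)))"
  proof (intro sum.cong refl)
    fix \<beta> assume "\<beta> \<in> {..min k n}"
    hence \<beta>: "\<beta> \<le> min k n" by simp
    have "(\<Sum>\<alpha> | \<alpha> \<in> ?A \<and> n - deficit n \<alpha> = \<beta>. g (n - deficit n \<alpha>) * (?P * signed_weight t x ?S (centered n \<alpha>)))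
        = (\<Sum>\<alpha> | \<alpha> \<in> compositions ?N d \<and> deficit n \<alpha> \<le> n \<and> n - deficit n \<alpha> = \<beta>.
             ?P * (g \<beta> * signed_weight t x ?S (centered n \<alpha>)))"
      by (intro sum.cong) auto
    also have "\<dots> = (\<Sum>a\<in>signed_vectors ?S (k - \<beta>) (n - \<beta>). ?P * (g \<beta> * signed_weight t x ?S a))"
      by (rule sum_compositions_centered[OF d \<beta>])
    finally show "(\<Sum>\<alpha> | \<alpha> \<in> ?A \<and> n - deficit n \<alpha> = \<beta>. g (n - deficit n \<alpha>) * (?P * signed_weight t x ?S (centered n \<alpha>)))
        = ?P * (g \<beta> * signed_sum t x ?S (k - \<beta>) (n - \<beta>))"
      by (simp only: signed_sum_def sum_distrib_left)
  qed
  also have "\<dots> = ?P * (\<Sum>\<beta>\<le>min k n. g \<beta> * signed_sum t x ?S (k - \<beta>) (n - \<beta>))"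
    by (rule sum_distrib_left[symmetric])
  also have "(\<Sum>\<beta>\<le>min k n. g \<beta> * signed_sum t x ?S (k - \<beta>) (n - \<beta>))
      = (\<Sum>\<beta>\<le>min k n. \<Sum>j\<le>min k n - \<beta>. g \<beta> * ?e j * h (\<beta> + j))"
  proof (intro sum.cong refl)
    fix \<beta> assume "\<beta> \<in> {..min k n}"
    have "min (k - \<beta>) (n - \<beta>) = min k n - \<beta>" by linarith
    moreover have "signed_sum t x ?S (k - \<beta>) (n - \<beta>) = (\<Sum>j\<le>min (k - \<beta>) (n - \<beta>). euler_coeff t (card ?S) j *
        complete_sym x ?S (k - \<beta> - j) * complete_sym (\<lambda>i. inverse (x i)) ?S (n - \<beta> - j))"
      using inj nz by (intro signed_sum_eq) auto
    ultimately show "g \<beta> * signed_sum t x ?S (k - \<beta>) (n - \<beta>) = (\<Sum>j\<le>min k n - \<beta>. g \<beta> * ?e j * h (\<beta> + j))"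
      by (simp only: h_def y_def sum_distrib_left card_lessThan diff_diff_left mult.assoc)
  qed
  also have "\<dots> = (\<Sum>l\<le>min k n. \<Sum>\<beta>\<le>l. g \<beta> * ?e (l - \<beta>) * h (\<beta> + (l - \<beta>)))"
  proof -
    have "(\<Sum>\<beta>\<le>min k n. \<Sum>j\<le>min k n - \<beta>. g \<beta> * ?e j * h (\<beta> + j))
       = (\<Sum>(\<beta>, j)\<in>Sigma {..min k n} (\<lambda>\<beta>. {..min k n - \<beta>}). g \<beta> * ?e j * h (\<beta> + j))"
      by (rule sum.Sigma) auto
    also have "Sigma {..min k n} (\<lambda>\<beta>. {..min k n - \<beta>}) = {(\<beta>, j). \<beta> + j \<le> min k n}" by auto
    finally show ?thesis unfolding sum.triangle_reindex_eq .
  qed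
  also have "\<dots> = (\<Sum>l\<le>min k n. (\<Sum>\<beta>\<le>l. g \<beta> * ?e (l - \<beta>)) * h l)"
    unfolding sum_distrib_right by (intro sum.cong refl) auto
  also have "\<dots> = (\<Sum>l\<le>min k n. (if l = 0 then h 0 else 0) - (if l = 1 then h 1 else 0))"
    unfolding g_def gauss_euler_convolution by (intro sum.cong refl) auto
  also have "\<dots> = h 0 - (if k = 0 \<or> n = 0 then 0 else h 1)"
    unfolding sum_subtractf by (auto simp: min_def)
  finally show ?thesis by (simp add: h_def)
qed

section \<open>Vanishing coordinates\<close>

lemma tendsto_prod_list_map:
  fixes X :: "'c \<Rightarrow> nat \<Rightarrow> real"
  assumes "\<And>i. ((\<lambda>e. X e i) \<longlongrightarrow> x i) F"
  shows "((\<lambda>e. prod_list (map (X e) w)) \<longlongrightarrow> prod_list (map x w)) F"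
  by (induction w) (auto intro!: tendsto_mult assms)

lemma tendsto_schur:
  assumes "\<And>i. ((\<lambda>e. X e i) \<longlongrightarrow> x i) F"
  shows "((\<lambda>e. schur lam N (X e)) \<longlongrightarrow> schur lam N x) F"
  unfolding schur_def by (intro tendsto_sum tendsto_prod_list_map assms)

lemma tendsto_hall_littlewood:
  assumes "\<And>i. ((\<lambda>e. X e i) \<longlongrightarrow> x i) F" "inj_on x {..<length \<nu>}"
  shows "((\<lambda>e. hall_littlewood \<nu> (X e) t) \<longlongrightarrow> hall_littlewood \<nu> x t) F"
  unfolding hall_littlewood_def
proof (intro tendsto_sum tendsto_mult tendsto_prod tendsto_power assms(1))
  fix \<alpha> p assume "p \<in> {(i, j). i < length \<nu> \<and> j < length \<nu> \<and> \<alpha> ! j < (\<alpha> ! i :: nat)}"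
  then obtain i j where p: "p = (i, j)" "i < length \<nu>" "j < length \<nu>" "i \<noteq> j" by auto
  have "x i - x j \<noteq> 0" using p assms(2) by (auto simp: inj_on_def)
  thus "((\<lambda>e. case p of (i, j) \<Rightarrow> (X e i - t * X e j) / (X e i - X e j)) \<longlongrightarrow> (case p of (i, j) \<Rightarrow> (x i - t * x j) / (x i - x j))) F"
    unfolding p(1) prod.case by (intro tendsto_intros assms(1))
qed

text \<open>
  Both sides are continuous at points with distinct coordinates, and agree when all coordinates are
  nonzero. A vanishing coordinate is reached by shifting all coordinates by a small \<open>e\<close>.
\<close>
lemma schur_near_rectangle_hall_littlewood:
  fixes x :: "nat \<Rightarrow> real"
  assumes d: "d + n = k + n * (b + 2)" and inj: "inj_on x {..<b + 2}"
  shows "schur ((n + k) # replicate b n) (b + 2) x =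
    (\<Sum>\<nu>\<in>partitions_of (b + 2) d. eval_int (kf_poly b n \<nu>) t * hall_littlewood \<nu> x t)"
proof -
  let ?F = "\<lambda>x. schur ((n + k) # replicate b n) (b + 2) x"
  let ?G = "\<lambda>x. \<Sum>\<nu>\<in>partitions_of (b + 2) d. eval_int (kf_poly b n \<nu>) t * hall_littlewood \<nu> x t"
  let ?X = "\<lambda>e i. x i + e"
  have X: "((\<lambda>e. ?X e i) \<longlongrightarrow> x i) (at 0)" for i
    by (rule tendsto_eq_intros refl | simp)+
  have "eventually (\<lambda>e. \<forall>i\<in>{..<b + 2}. ?X e i \<noteq> 0) (at 0)"
  proof (intro eventually_ball_finite ballI finite_lessThan)
    fix i
    have "eventually (\<lambda>e. e \<noteq> - x i) (at 0)" by (rule eventually_neq_at_within)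
    thus "eventually (\<lambda>e. ?X e i \<noteq> 0) (at 0)" by eventually_elim linarith
  qed
  hence "eventually (\<lambda>e. ?F (?X e) = ?G (?X e)) (at 0)"
  proof eventually_elim
    case (elim e)
    have "inj_on (?X e) {..<b + 2}" using inj by (auto simp: inj_on_def)
    thus ?case using elim
      by (subst schur_near_rectangle, simp, subst hall_littlewood_expansion_complete_sym[OF d]) auto
  qed
  moreover have "((\<lambda>e. ?F (?X e)) \<longlongrightarrow> ?F x) (at 0)" by (rule tendsto_schur[OF X])
  moreover have "((\<lambda>e. ?G (?X e)) \<longlongrightarrow> ?G x) (at 0)"
    using inj by (intro tendsto_sum tendsto_mult tendsto_const tendsto_hall_littlewood[OF X]) (auto simp: partitions_of_def)
  ultimately show ?thesis
    by (intro LIM_unique[of "\<lambda>e. ?G (?X e)" _ 0]) (auto intro: Lim_transform_eventually)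
qed

section \<open>The Kostka-Foulkes polynomials\<close>

lemma eval_int_eqI:
  assumes "\<And>t :: real. t \<noteq> 0 \<Longrightarrow> eval_int p t = eval_int r t"
  shows "p = r"
proof -
  have "(map_poly of_int p :: real poly) = map_poly of_int r"
  proof (rule ccontr)
    \<comment> \<open>A nonzero polynomial cannot vanish at all nonzero reals.\<close>
    let ?d = "(map_poly of_int p :: real poly) - map_poly of_int r"
    assume "(map_poly of_int p :: real poly) \<noteq> map_poly of_int r"
    hence "finite {t. poly ?d t = 0}" by (intro poly_roots_finite) simp
    moreover have "- {0} \<subseteq> {t. poly ?d t = 0}" using assms by (auto simp: eval_int_def)
    ultimately have "finite (- {0 :: real})" using finite_subset by blast
    thus False using infinite_UNIV_char_0[where 'a = real] by simp
  qed
  hence "coeff (map_poly of_int p :: real poly) n = coeff (map_poly of_int r) n" for n by simp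
  thus ?thesis by (intro poly_eqI) (simp add: coeff_map_poly)
qed

lemma kostka_foulkes_near_rectangle:
  assumes "length \<nu> = b + 2" "sorted_wrt (\<ge>) \<nu>" "sum_list \<nu> = n + k + n * b"
  shows "kostka_foulkes ((n + k) # replicate b n) \<nu> = kf_poly b n \<nu>"
proof -
  let ?lam = "(n + k) # replicate b n"
  let ?d = "n + k + n * b"
  let ?N = "b + 2"
  define K where "K \<nu> = (if \<nu> \<in> partitions_of ?N ?d then kf_poly b n \<nu> else 0)" for \<nu>
  have sum: "sum_list ?lam = ?d" by (simp add: sum_list_replicate mult.commute)
  have N: "max (length ?lam) (length \<nu>) = ?N" using assms(1) by simp
  have d: "?d + n = k + n * (b + 2)" by (simp add: algebra_simps)
  have "kostka_foulkes_family ?N ?lam = K"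
    unfolding kostka_foulkes_family_def sum eval_int_def[symmetric]
  proof (rule the_equality, intro conjI allI impI)
    show "K \<nu> = 0" if "\<nu> \<notin> partitions_of ?N ?d" for \<nu> using that by (simp add: K_def)
    fix t :: real and x :: "nat \<Rightarrow> real" assume "inj_on x {..<?N}"
    thus "schur ?lam ?N x = (\<Sum>\<nu>\<in>partitions_of ?N ?d. eval_int (K \<nu>) t * hall_littlewood \<nu> x t)"
      by (subst schur_near_rectangle_hall_littlewood[OF d, of x t]) (auto intro!: sum.cong simp: K_def)
  next
    fix K'
    assume K': "(\<forall>\<nu>. \<nu> \<notin> partitions_of ?N ?d \<longrightarrow> K' \<nu> = 0) \<and>
      (\<forall>t x. inj_on x {..<?N} \<longrightarrow> schur ?lam ?N x = (\<Sum>\<nu>\<in>partitions_of ?N ?d. eval_int (K' \<nu>) t * hall_littlewood \<nu> x t))"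
    show "K' = K"
    proof
      fix \<nu>
      show "K' \<nu> = K \<nu>"
      proof (cases "\<nu> \<in> partitions_of ?N ?d")
        case False
        thus ?thesis using K' by (simp add: K_def)
      next
        case True
        show ?thesis
        proof (rule eval_int_eqI)
          fix t :: real assume t: "t \<noteq> 0"
          let ?c = "\<lambda>\<nu>. eval_int (K' \<nu>) t - eval_int (K \<nu>) t"
          have "(\<Sum>\<alpha>\<in>compositions ?N ?d. ?c (rev (sort \<alpha>)) * hl_term t x \<alpha>) = 0" if x: "inj_on x {..<?N}" for x
          proof -
            have "(\<Sum>\<nu>\<in>partitions_of ?N ?d. eval_int (K \<nu>) t * hall_littlewood \<nu> x t)
               = (\<Sum>\<nu>\<in>partitions_of ?N ?d. eval_int (kf_poly b n \<nu>) t * hall_littlewood \<nu> x t)"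
              by (intro sum.cong) (auto simp: K_def)
            hence "(\<Sum>\<nu>\<in>partitions_of ?N ?d. ?c \<nu> * hall_littlewood \<nu> x t) = 0"
              using K' x schur_near_rectangle_hall_littlewood[OF d x, of t]
              by (simp add: left_diff_distrib sum_subtractf)
            thus ?thesis by (simp only: sum_partitions_hall_littlewood)
          qed
          moreover have "\<nu> \<in> compositions ?N ?d" using True by (simp add: compositions_def partitions_of_def)
          ultimately have "?c (rev (sort \<nu>)) = 0" by (rule hl_terms_independent[OF _ t])
          moreover have "sort \<nu> = rev \<nu>"
            using True properties_for_sort[of "rev \<nu>" \<nu>] by (simp add: partitions_of_def sorted_wrt_rev)
          ultimately show "eval_int (K' \<nu>) t = eval_int (K \<nu>) t" by simp
        qed
      qed
    qed
  qed
  moreover have "\<nu> \<in> partitions_of ?N ?d" using assms by (simp add: partitions_of_def)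
  ultimately show ?thesis
    using assms(1) unfolding kostka_foulkes_def N by (simp add: pad_def K_def)
qed

text \<open>
  In a weakly decreasing \<open>\<nu>\<close>, the pair \<open>i < j\<close> overlaps in the positive part of \<open>\<nu> ! j - n\<close> and in the negative
  part of \<open>\<nu> ! i - n\<close>. So the overlap counts positive parts with weight \<open>j\<close>, and negative parts with weight \<open>b + 1 - i\<close>.
\<close>
lemma kappa_eq:
  assumes len: "length \<nu> = b + 2" and sorted: "sorted_wrt (\<ge>) \<nu>"
  shows "kappa \<nu> + (b + 1) * deficit n \<nu> = n * ((b + 2) choose 2) + overlap_exponent n \<nu>"
proof -
  let ?N = "b + 2"
  have mono: "\<nu> ! j \<le> \<nu> ! i" if "i < j" "j < ?N" for i j
    using sorted that len by (simp add: sorted_wrt_iff_nth_less)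
  have "overlap_exponent n \<nu> = (\<Sum>i<?N. \<Sum>j<?N. (if i < j then \<nu> ! j - n else 0) + (if i < j then n - \<nu> ! i else 0))"
    unfolding overlap_exponent_def len
  proof (intro sum.cong refl)
    fix i j assume "i \<in> {..<?N}" "j \<in> {..<?N}"
    thus "(if i < j then min (\<nu> ! i - n) (\<nu> ! j - n) + min (n - \<nu> ! i) (n - \<nu> ! j) else 0)
       = (if i < j then \<nu> ! j - n else 0) + (if i < j then n - \<nu> ! i else 0)"
      using mono[of i j] by auto
  qed
  also have "\<dots> = (\<Sum>j<?N. \<Sum>i<?N. if i < j then \<nu> ! j - n else 0) + (\<Sum>i<?N. \<Sum>j<?N. if i < j then n - \<nu> ! i else 0)"
    unfolding sum.distrib by (subst sum.swap) simp
  also have "(\<Sum>j<?N. \<Sum>i<?N. if i < j then \<nu> ! j - n else 0) = (\<Sum>j<?N. j * (\<nu> ! j - n))"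
  proof (intro sum.cong refl)
    fix j assume "j \<in> {..<?N}"
    hence "{i \<in> {..<?N}. i < j} = {..<j}" by auto
    thus "(\<Sum>i<?N. if i < j then \<nu> ! j - n else 0) = j * (\<nu> ! j - n)"
      by (simp add: sum.inter_filter[symmetric] del: sum.lessThan_Suc)
  qed
  also have "(\<Sum>i<?N. \<Sum>j<?N. if i < j then n - \<nu> ! i else 0) = (\<Sum>i<?N. (b + 1 - i) * (n - \<nu> ! i))"
  proof (intro sum.cong refl)
    fix i assume "i \<in> {..<?N}"
    have "{j \<in> {..<?N}. i < j} = {i<..<?N}" by auto
    thus "(\<Sum>j<?N. if i < j then n - \<nu> ! i else 0) = (b + 1 - i) * (n - \<nu> ! i)"
      by (simp add: sum.inter_filter[symmetric] del: sum.lessThan_Suc)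
  qed
  finally have E: "overlap_exponent n \<nu> = (\<Sum>i<?N. i * (\<nu> ! i - n) + (b + 1 - i) * (n - \<nu> ! i))"
    by (simp only: sum.distrib)
  have "kappa \<nu> + (b + 1) * deficit n \<nu> = (\<Sum>i<?N. i * \<nu> ! i + (b + 1) * (n - \<nu> ! i))"
    by (simp only: kappa_def deficit_def len sum.distrib sum_distrib_left)
  also have "\<dots> = (\<Sum>i<?N. n * i + (i * (\<nu> ! i - n) + (b + 1 - i) * (n - \<nu> ! i)))"
  proof (intro sum.cong refl)
    fix i assume "i \<in> {..<?N}"
    then obtain l where l: "b + 1 = i + l" using le_Suc_ex[of i "b + 1"] by auto
    show "i * \<nu> ! i + (b + 1) * (n - \<nu> ! i) = n * i + (i * (\<nu> ! i - n) + (b + 1 - i) * (n - \<nu> ! i))"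
    proof (cases "\<nu> ! i \<le> n")
      case True
      then obtain c where "n = \<nu> ! i + c" using le_Suc_ex by blast
      thus ?thesis unfolding l by (simp add: algebra_simps)
    next
      case False
      then obtain c where "\<nu> ! i = n + c" using le_Suc_ex[of n "\<nu> ! i"] by auto
      thus ?thesis unfolding l by (simp add: algebra_simps)
    qed
  qed
  also have "\<dots> = n * (\<Sum>i<?N. i) + overlap_exponent n \<nu>"
    unfolding E sum.distrib sum_distrib_left ..
  also have "(\<Sum>i<?N. i) = ((b + 2) choose 2)"
  proof -
    have "(\<Sum>i<N. i) = (N choose 2)" for N :: nat
      by (induction N) (simp_all add: numeral_2_eq_2)
    thus ?thesis .
  qed
  finally show ?thesis .
qed

lemma beta_eq:
  assumes "length \<mu> = b + 2" "sum_list \<mu> = n + k + n * b"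
  shows "beta (n + k) n \<mu> = int n - int (deficit n \<mu>)"
proof -
  have "int (sum_list \<mu>) = (\<Sum>i<b + 2. int (\<mu> ! i))"
    using sum_list_map_conv_sum[of "\<lambda>u. u" \<mu>] assms(1) by simp
  also have "\<dots> = (\<Sum>i<b + 2. int n + ((if \<mu> ! i > n then int (\<mu> ! i) - int n else 0) - int (n - \<mu> ! i)))"
    by (intro sum.cong) auto
  also have "\<dots> = int (b + 2) * int n + ((\<Sum>i<b + 2. if \<mu> ! i > n then int (\<mu> ! i) - int n else 0) - int (deficit n \<mu>))"
    unfolding sum.distrib sum_subtractf deficit_def assms(1) of_nat_sum by simp
  finally show ?thesis using assms by (simp add: beta_def algebra_simps)
qed

theorem corollary4p10:
  fixes m n b :: nat and \<mu> :: "nat list"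
  assumes "m > 0" and "n > 0" and "b > 0" and "m \<ge> n"
    and "length \<mu> = b + 2"
    and "sum_list \<mu> = m + n * b"
  shows "qbinomial qvar (int b + beta m n \<mu>) (beta m n \<mu>) =
    qvar powi (- int (n * ((b + 1) choose 2))) *
      modified_kostka_foulkes (m # replicate b n) \<mu>"
proof -
  define \<nu> where "\<nu> = rev (sort \<mu>)"
  obtain k where m: "m = n + k" using assms(4) le_Suc_ex by blast
  have mset: "mset \<nu> = mset \<mu>" by (simp add: \<nu>_def)
  have len: "length \<nu> = b + 2" and sorted: "sorted_wrt (\<ge>) \<nu>" and sum: "sum_list \<nu> = n + k + n * b"
    using assms(5,6) sum_list_map_mset_cong[OF mset, of "\<lambda>u. u"] by (simp_all add: \<nu>_def sorted_wrt_rev m)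
  have def: "deficit n \<nu> = deficit n \<mu>" using mset by (rule deficit_mset_cong)
  have \<beta>: "beta m n \<mu> = int n - int (deficit n \<nu>)"
    unfolding m def using assms(5,6) by (intro beta_eq[of _ b]) (simp_all add: m)
  have K: "modified_kostka_foulkes (m # replicate b n) \<mu> = qvar ^ kappa \<nu> * eval_int (kf_poly b n \<nu>) (inverse qvar)"
    unfolding modified_kostka_foulkes_def Let_def \<nu>_def[symmetric] eval_int_def[symmetric] m
    by (simp only: kostka_foulkes_near_rectangle[OF len sorted sum])
  show ?thesis
  proof (cases "deficit n \<nu> \<le> n")
    case False
    thus ?thesis unfolding K \<beta> by (simp add: kf_poly_def qbinomial_def)
  next
    case True
    define j where "j = n - deficit n \<nu>"
    have n: "n = deficit n \<nu> + j" using True by (simp add: j_def)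
    have bj: "beta m n \<mu> = int j" using \<beta> True by (simp add: j_def)
    have "kappa \<nu> + (b + 1) * deficit n \<nu> = n * ((b + 1) choose 2) + n * (b + 1) + overlap_exponent n \<nu>"
      unfolding kappa_eq[OF len sorted] by (simp add: numeral_2_eq_2 algebra_simps)
    moreover have "n * (b + 1) = (b + 1) * deficit n \<nu> + (b * j + j)"
      by (subst n) (simp add: algebra_simps)
    ultimately have \<kappa>: "kappa \<nu> = n * ((b + 1) choose 2) + b * j + (overlap_exponent n \<nu> + j)"
      by linarith
    have "eval_int (kf_poly b n \<nu>) (inverse qvar) = inverse qvar ^ (overlap_exponent n \<nu> + j) * eval_int (gauss_poly b j) (inverse qvar)"
      unfolding kf_poly_def if_P[OF True] j_def[symmetric] by simp
    hence "qvar powi (- int (n * ((b + 1) choose 2))) * modified_kostka_foulkes (m # replicate b n) \<mu>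
       = qvar ^ (b * j) * eval_int (gauss_poly b j) (inverse qvar)"
      unfolding K \<kappa> using qvar_nonzero
      by (simp only: power_add power_int_minus power_int_of_nat) (simp add: field_simps)
    also have "\<dots> = qfactorial qvar (b + j) / (qfactorial qvar j * qfactorial qvar b)"
      by (simp only: eval_gauss_poly_inverse[OF qvar_nonzero qvar_power_neq_1] eval_gauss_poly[OF qvar_power_neq_1])
    also have "\<dots> = qbinomial qvar (int b + beta m n \<mu>) (beta m n \<mu>)"
      by (simp add: bj qbinomial_def nat_add_distrib)
    finally show ?thesis ..
  qed
qed

end
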